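(* Let $(W,S)$ be a Coxeter system with a fixed reflection order $\mathcal{O}$, and let $F=(F_{u,v})_{u<v}$ be a flip (see context) that is compatible with $\mathcal{O}$. Let $u<v$ in the Bruhat order and let $M(\mathbf{c},\mathbf{d})$ be a $\mathbf{c}\mathbf{d}$-monomial of degree $n$ (where $\deg\mathbf{c}=1$, $\deg\mathbf{d}=2$). Then the coefficient of $M$ in the complete $\mathbf{c}\mathbf{d}$-index $\widetilde{\psi}_{u,v}(\mathbf{c},\mathbf{d})$ is equal to \[ \sum_{x\in B_n(u,v)} s_M(x).\]
   Context: $(W,S)$ is a Coxeter system, $T$ its set of reflections (conjugates of elements of $S$), $l$ the length function. A reflection order $\mathcal{O}$ is a total order on $T$ such that for every dihedral reflection subgroup $W'$ of $W$ with canonical generators $a,b$, the reflections of $W'$ occur in $\mathcal{O}$ in the order $a, aba, ababa,\dots, bab, b$ or in the reverse order; its reverse $\overline{\mathcal{O}}$ is again a reflection order. Write $u\prec v$ if $l(u)<l(v)$ and $u^{-1}v\in T$; this generates the Bruhat order. A path of length $n$ from $u$ to $v$ is a sequence $x=(u=x_0\prec x_1\prec\cdots\prec x_n\prec x_{n+1}=v)$ (so $(u\prec v)$ has length $0$); $B_n(u,v)$ is the set of such paths and $B(u,v)=\bigcup_n B_n(u,v)$. The edge $x_i\prec x_{i+1}$ is labeled by $t_i=x_i^{-1}x_{i+1}$, and the ascent-descent sequence of $x$ is the word $w(x)=\beta_1\cdots\beta_n$ in non-commuting variables $A,D$ with $\beta_i=A$ if $t_{i-1}<t_i$ in $\mathcal{O}$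 and $\beta_i=D$ if $t_{i-1}>t_i$. Set $\widetilde{\phi}_{u,v}(A,D)=\sum_{x\in B(u,v)}w(x)\in\mathbb{Z}\langle A,D\rangle$. With $\mathbf{c}=A+D$, $\mathbf{d}=AD+DA$, it is known (Billera–Brenti) that $\widetilde{\phi}_{u,v}$ lies in $\mathbb{Z}\langle\mathbf{c},\mathbf{d}\rangle$; written as a polynomial in $\mathbf{c},\mathbf{d}$ it is the complete $\mathbf{c}\mathbf{d}$-index $\widetilde{\psi}_{u,v}(\mathbf{c},\mathbf{d})$. For an $AD$-word $f$, $\overline{f}$ is obtained by swapping $A$ and $D$. A flip is a choice, for every pair $u<v$, of an involution $F_{u,v}:B(u,v)\to B(u,v)$ with $w(F_{u,v}(x))=\overline{w(x)}$ for all $x$. For $x=(u\prec x_1\prec\cdots\prec x_n\prec v)\in B_n(u,v)$ with $w(x)=\beta_1\cdots\beta_n$ and $1\le m\le n$, let $(x_m\prec y_{m+1}\prec\cdots\prec y_n\prec v)=F_{x_m,v}(x_m\prec x_{m+1}\prec\cdots\prec x_n\prec v)$ and let $y=(u\prec x_1\prec\cdots\prec x_m\prec y_{m+1}\prec\cdots\prec y_n\prec v)$; let $\alpha_m$ be the $m$-th letter of $w(y)$. Define $s_{m,A}(x)=1$ if $\beta_m=A$ and $0$ otherwise; $s_{m,D}(x)=1$ if $\beta_m=D,\alpha_m=A$; $s_{m,D}(x)=-1$ if $\beta_m=A,\alpha_m=D$; and $s_{m,D}(x)=0$ otherwise. For a $\mathbf{c}\mathbf{d}$-monomial $M$ of degree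 $n$, let $\gamma_1\cdots\gamma_n=M(A,DA)$ be the $AD$-monomial obtained by substituting $\mathbf{c}\mapsto A$, $\mathbf{d}\mapsto DA$, and set $s_M(x)=\prod_{m=1}^n s_{m,\gamma_m}(x)$. Let $\overline{s}_M$ denote the same quantity computed with the same flip $F$ but with the reverse order $\overline{\mathcal{O}}$ in place of $\mathcal{O}$. The flip $F$ is compatible with $\mathcal{O}$ if $s_M(x)=\overline{s}_M(F_{u,v}(x))$ for all $u<v$, all $\mathbf{c}\mathbf{d}$-monomials $M$ of degree $n$, and all $x\in B_n(u,v)$. *)

theory Defs
  imports "HOL-Algebra.Algebra" "HOL-Library.Poly_Mapping"
begin

section \<open>Coxeter systems\<close>

definition word_eval :: "('a, 'b) monoid_scheme \<Rightarrow> 'a list \<Rightarrow> 'a" where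
  "word_eval W ws = foldr (\<lambda>s w. s \<otimes>\<^bsub>W\<^esub> w) ws \<one>\<^bsub>W\<^esub>"

text \<open>
  Deletion of one relator \<open>(s t)^m\<close>, where \<open>m\<close> is the order of \<open>s t\<close>; \<open>group.ord\<close> is \<open>0\<close> for
  elements of infinite order, which give no relator. The case \<open>s = t\<close> is the relator \<open>s s\<close>, so the
  group and the monoid presented by these relators coincide, and words over \<open>S\<close> without formal
  inverses suffice.
\<close>
inductive coxeter_relator_deletion ::
  "('a, 'b) monoid_scheme \<Rightarrow> 'a set \<Rightarrow> 'a list \<Rightarrow> 'a list \<Rightarrow> bool" for W S where
  "\<lbrakk>xs \<in> lists S; ys \<in> lists S; s \<in> S; t \<in> S; group.ord W (s \<otimes>\<^bsub>W\<^esub> t) \<noteq> 0\<rbrakk> \<Longrightarrow>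
    coxeter_relator_deletion W S
      (xs @ concat (replicate (group.ord W (s \<otimes>\<^bsub>W\<^esub> t)) [s, t]) @ ys) (xs @ ys)"

text \<open>
  \<open>W\<close> is generated by the set \<open>S\<close> of involutions and is presented by the relators
  \<open>(s t)^m\<close>: two words over \<open>S\<close> with the same value in \<open>W\<close> are congruent modulo the relators.
\<close>
locale coxeter_system = group W for W :: "('a, 'b) monoid_scheme" (structure) +
  fixes S :: "'a set"
  assumes generators_subset: "S \<subseteq> carrier W"
    and generators_order: "\<And>s. s \<in> S \<Longrightarrow> group.ord W s = 2"
    and generators_generate: "generate W S = carrier W"
    and presentation: "\<And>xs ys. \<lbrakk>xs \<in> lists S; ys \<in> lists S; word_eval W xs = word_eval W ys\<rbrakk> \<Longrightarrow>
      equivclp (coxeter_relator_deletion W S) xs ys"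

definition cox_length :: "('a, 'b) monoid_scheme \<Rightarrow> 'a set \<Rightarrow> 'a \<Rightarrow> nat" where
  "cox_length W S w = (LEAST n. \<exists>ws \<in> lists S. length ws = n \<and> word_eval W ws = w)"

definition reflections :: "('a, 'b) monoid_scheme \<Rightarrow> 'a set \<Rightarrow> 'a set" where
  "reflections W S = {w \<otimes>\<^bsub>W\<^esub> s \<otimes>\<^bsub>W\<^esub> inv\<^bsub>W\<^esub> w | w s. w \<in> carrier W \<and> s \<in> S}"

section \<open>Reflection orders\<close>

definition left_inversions :: "('a, 'b) monoid_scheme \<Rightarrow> 'a set \<Rightarrow> 'a \<Rightarrow> 'a set" where
  "left_inversions W S w =
     {t \<in> reflections W S. cox_length W S (t \<otimes>\<^bsub>W\<^esub> w) < cox_length W S w}"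

text \<open>
  The canonical generators, in the sense of Dyer, of a reflection subgroup \<open>H\<close>; they are the
  Coxeter generators of \<open>H\<close> determined by \<open>(W, S)\<close>.
\<close>
definition canonical_generators :: "('a, 'b) monoid_scheme \<Rightarrow> 'a set \<Rightarrow> 'a set \<Rightarrow> 'a set" where
  "canonical_generators W S H = {t \<in> reflections W S. left_inversions W S t \<inter> H = {t}}"

definition dihedral_reflection_subgroup :: "('a, 'b) monoid_scheme \<Rightarrow> 'a set \<Rightarrow> 'a set \<Rightarrow> bool" where
  "dihedral_reflection_subgroup W S H \<longleftrightarrow>
     (\<exists>t \<in> reflections W S. \<exists>t' \<in> reflections W S. t \<noteq> t' \<and> H = generate W {t, t'})"

text \<open>
  \<open>dihedral_chain W R a b\<close>: the relation \<open>R\<close> orders the reflections of the dihedral group generated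
  by \<open>a\<close> and \<open>b\<close> as \<open>a, aba, ababa, \<dots>, bab, b\<close>. If \<open>a b\<close> has finite order \<open>m\<close>, these are the
  elements \<open>(ab)^i a\<close> with \<open>i < m\<close> (the last one, \<open>i = m - 1\<close>, being \<open>b\<close>). If \<open>a b\<close> has infinite
  order, they are the increasing sequence \<open>(ab)^i a\<close> followed by the decreasing sequence
  \<open>(ba)^i b\<close>.
\<close>
definition dihedral_chain :: "('a, 'b) monoid_scheme \<Rightarrow> 'a rel \<Rightarrow> 'a \<Rightarrow> 'a \<Rightarrow> bool" where
  "dihedral_chain W R a b \<longleftrightarrow>
    (let m = group.ord W (a \<otimes>\<^bsub>W\<^esub> b);
         p = (\<lambda>i::nat. (a \<otimes>\<^bsub>W\<^esub> b) [^]\<^bsub>W\<^esub> i \<otimes>\<^bsub>W\<^esub> a);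
         q = (\<lambda>i::nat. (b \<otimes>\<^bsub>W\<^esub> a) [^]\<^bsub>W\<^esub> i \<otimes>\<^bsub>W\<^esub> b)
     in if m \<noteq> 0 then (\<forall>i j. i < j \<and> j < m \<longrightarrow> (p i, p j) \<in> R)
        else (\<forall>i j. i < j \<longrightarrow> (p i, p j) \<in> R \<and> (q j, q i) \<in> R) \<and> (\<forall>i j. (p i, q j) \<in> R))"

text \<open>Total orders on the reflections are given by their strict part; the reverse order is \<open>R\<inverse>\<close>.\<close>
definition reflection_order :: "('a, 'b) monoid_scheme \<Rightarrow> 'a set \<Rightarrow> 'a rel \<Rightarrow> bool" where
  "reflection_order W S R \<longleftrightarrow>
     R \<subseteq> reflections W S \<times> reflections W S \<and>
     strict_linear_order_on (reflections W S) R \<and>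
     (\<forall>H a b. dihedral_reflection_subgroup W S H \<and> canonical_generators W S H = {a, b} \<longrightarrow>
        dihedral_chain W R a b \<or> dihedral_chain W (R\<inverse>) a b)"

section \<open>Bruhat order and paths\<close>

definition bruhat_edges :: "('a, 'b) monoid_scheme \<Rightarrow> 'a set \<Rightarrow> 'a rel" where
  "bruhat_edges W S = {(u, v). u \<in> carrier W \<and> v \<in> carrier W \<and>
     cox_length W S u < cox_length W S v \<and> inv\<^bsub>W\<^esub> u \<otimes>\<^bsub>W\<^esub> v \<in> reflections W S}"

definition bruhat_less :: "('a, 'b) monoid_scheme \<Rightarrow> 'a set \<Rightarrow> 'a \<Rightarrow> 'a \<Rightarrow> bool" where
  "bruhat_less W S u v \<longleftrightarrow> (u, v) \<in> (bruhat_edges W S)\<^sup>+"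

text \<open>
  A path of length \<open>n\<close> has \<open>n + 1\<close> edges; it is the list \<open>x\<^sub>0, \<dots>, x\<^bsub>n+1\<^esub>\<close> of its \<open>n + 2\<close> vertices,
  so that \<open>x ! i\<close> is \<open>x\<^sub>i\<close>.
\<close>
definition paths_of_length ::
  "('a, 'b) monoid_scheme \<Rightarrow> 'a set \<Rightarrow> nat \<Rightarrow> 'a \<Rightarrow> 'a \<Rightarrow> 'a list set" where
  "paths_of_length W S n u v = {x. length x = n + 2 \<and> hd x = u \<and> last x = v \<and>
     successively (\<lambda>a b. (a, b) \<in> bruhat_edges W S) x}"

definition paths :: "('a, 'b) monoid_scheme \<Rightarrow> 'a set \<Rightarrow> 'a \<Rightarrow> 'a \<Rightarrow> 'a list set" where
  "paths W S u v = (\<Union>n. paths_of_length W S n u v)"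

datatype ad_letter = LetA | LetD

fun ad_swap :: "ad_letter \<Rightarrow> ad_letter" where
  "ad_swap LetA = LetD"
| "ad_swap LetD = LetA"

definition edge_label :: "('a, 'b) monoid_scheme \<Rightarrow> 'a list \<Rightarrow> nat \<Rightarrow> 'a" where
  "edge_label W x i = inv\<^bsub>W\<^esub> (x ! i) \<otimes>\<^bsub>W\<^esub> x ! Suc i"

text \<open>
  The letter \<open>\<beta>\<^sub>i\<close> for \<open>1 \<le> i \<le> n\<close>. Consecutive labels of a path are distinct reflections, so the
  second case is \<open>t\<^bsub>i-1\<^esub> > t\<^sub>i\<close>.
\<close>
definition path_letter :: "('a, 'b) monoid_scheme \<Rightarrow> 'a rel \<Rightarrow> 'a list \<Rightarrow> nat \<Rightarrow> ad_letter" where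
  "path_letter W R x i =
     (if (edge_label W x (i - 1), edge_label W x i) \<in> R then LetA else LetD)"

definition path_word :: "('a, 'b) monoid_scheme \<Rightarrow> 'a rel \<Rightarrow> 'a list \<Rightarrow> ad_letter list" where
  "path_word W R x = map (path_letter W R x) [1..<length x - 1]"

section \<open>Non-commutative polynomials and the complete cd-index\<close>

text \<open>
  The free monoid, written additively (and non-commutatively) so that \<open>'x monom \<Rightarrow>\<^sub>0 int\<close>, with the
  convolution product of \<open>poly_mapping\<close>, is the ring of integer polynomials in non-commuting
  variables from \<open>'x\<close>.
\<close>
datatype 'x monom = Monom (letters: "'x list")

instantiation monom :: (type) monoid_add
begin

definition zero_monom :: "'x monom" where
  "zero_monom = Monom []"

definition plus_monom :: "'x monom \<Rightarrow> 'x monom \<Rightarrow> 'x monom" where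
  "plus_monom M N = Monom (letters M @ letters N)"

instance
  by standard (simp_all add: zero_monom_def plus_monom_def)

end

type_synonym 'x ncpoly = "'x monom \<Rightarrow>\<^sub>0 int"

definition nc_var :: "'x \<Rightarrow> 'x ncpoly" where
  "nc_var a = Poly_Mapping.single (Monom [a]) 1"

definition nc_subst :: "('x \<Rightarrow> 'r::ring_1) \<Rightarrow> 'x ncpoly \<Rightarrow> 'r" where
  "nc_subst f p = (\<Sum>M \<in> Poly_Mapping.keys p.
     of_int (Poly_Mapping.lookup p M) * prod_list (map f (letters M)))"

datatype cd_letter = Letc | Letd

fun cd_to_ad :: "cd_letter \<Rightarrow> ad_letter ncpoly" where
  "cd_to_ad Letc = nc_var LetA + nc_var LetD"
| "cd_to_ad Letd = nc_var LetA * nc_var LetD + nc_var LetD * nc_var LetA"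

definition cd_degree :: "cd_letter monom \<Rightarrow> nat" where
  "cd_degree M = sum_list (map (\<lambda>z. case z of Letc \<Rightarrow> 1 | Letd \<Rightarrow> 2) (letters M))"

definition complete_ad_index ::
  "('a, 'b) monoid_scheme \<Rightarrow> 'a set \<Rightarrow> 'a rel \<Rightarrow> 'a \<Rightarrow> 'a \<Rightarrow> ad_letter ncpoly" where
  "complete_ad_index W S R u v =
     (\<Sum>x \<in> paths W S u v. Poly_Mapping.single (Monom (path_word W R x)) 1)"

definition complete_cd_index ::
  "('a, 'b) monoid_scheme \<Rightarrow> 'a set \<Rightarrow> 'a rel \<Rightarrow> 'a \<Rightarrow> 'a \<Rightarrow> cd_letter ncpoly" where
  "complete_cd_index W S R u v =
     (THE p. nc_subst cd_to_ad p = complete_ad_index W S R u v)"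

section \<open>Flips\<close>

definition is_flip ::
  "('a, 'b) monoid_scheme \<Rightarrow> 'a set \<Rightarrow> 'a rel \<Rightarrow> ('a \<Rightarrow> 'a \<Rightarrow> 'a list \<Rightarrow> 'a list) \<Rightarrow> bool" where
  "is_flip W S R F \<longleftrightarrow> (\<forall>u v. bruhat_less W S u v \<longrightarrow> (\<forall>x \<in> paths W S u v.
     F u v x \<in> paths W S u v \<and> F u v (F u v x) = x \<and>
     path_word W R (F u v x) = map ad_swap (path_word W R x)))"

definition flip_tail :: "('a \<Rightarrow> 'a \<Rightarrow> 'a list \<Rightarrow> 'a list) \<Rightarrow> nat \<Rightarrow> 'a list \<Rightarrow> 'a list" where
  "flip_tail F m x = take m x @ F (x ! m) (last x) (drop m x)"

fun s_letter ::
  "('a, 'b) monoid_scheme \<Rightarrow> 'a rel \<Rightarrow> ('a \<Rightarrow> 'a \<Rightarrow> 'a list \<Rightarrow> 'a list) \<Rightarrow>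
    nat \<Rightarrow> ad_letter \<Rightarrow> 'a list \<Rightarrow> int" where
  "s_letter W R F m LetA x = (if path_letter W R x m = LetA then 1 else 0)"
| "s_letter W R F m LetD x =
     (let \<beta> = path_letter W R x m; \<alpha> = path_letter W R (flip_tail F m x) m
      in if \<beta> = LetD \<and> \<alpha> = LetA then 1 else if \<beta> = LetA \<and> \<alpha> = LetD then - 1 else 0)"

text \<open>The word \<open>M(A, DA)\<close>; its length is the degree of \<open>M\<close>.\<close>
definition cd_word :: "cd_letter monom \<Rightarrow> ad_letter list" where
  "cd_word M = concat (map (\<lambda>z. case z of Letc \<Rightarrow> [LetA] | Letd \<Rightarrow> [LetD, LetA]) (letters M))"

definition s_monom ::
  "('a, 'b) monoid_scheme \<Rightarrow> 'a rel \<Rightarrow> ('a \<Rightarrow> 'a \<Rightarrow> 'a list \<Rightarrow> 'a list) \<Rightarrow>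
    cd_letter monom \<Rightarrow> 'a list \<Rightarrow> int" where
  "s_monom W R F M x = (\<Prod>m = 1..cd_degree M. s_letter W R F m (cd_word M ! (m - 1)) x)"

definition compatible_flip ::
  "('a, 'b) monoid_scheme \<Rightarrow> 'a set \<Rightarrow> 'a rel \<Rightarrow> ('a \<Rightarrow> 'a \<Rightarrow> 'a list \<Rightarrow> 'a list) \<Rightarrow> bool" where
  "compatible_flip W S R F \<longleftrightarrow> (\<forall>u v M. bruhat_less W S u v \<longrightarrow>
     (\<forall>x \<in> paths_of_length W S (cd_degree M) u v.
        s_monom W R F M x = s_monom W (R\<inverse>) F M (F u v x)))"

end

theory Submission
  imports Defs
begin

text \<open>
  A functional on word coefficients, given by \<open>f \<mapsto> f(A w)\<close> for each letter \<open>c\<close> and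
  \<open>f \<mapsto> f(D A w) - f(D D w')\<close> (\<open>w'\<close> being \<open>w\<close> with \<open>A\<close> and \<open>D\<close> swapped) for each letter \<open>d\<close> of
  \<open>M\<close>, reads off the coefficient of \<open>M\<close> in every polynomial in \<open>c\<close> and \<open>d\<close>. On path counts
  it yields the sum of \<open>s\<^sub>M\<close>: reversing the order swaps \<open>A\<close> and \<open>D\<close>, and compatibility says that
  on \<open>s\<^sub>M\<close> this has the same effect as the flip.

  That the path polynomial is a polynomial in \<open>c\<close> and \<open>d\<close> at all follows from the flips: all
  intervals have swap-symmetric word counts, and summing over one letter of a word splits the
  count into a convolution of counts over two shorter intervals. Finiteness of intervals rests
  on the strong exchange property, proved by counting the reflections of a word modulo two.
\<close>

subsection \<open>Strong exchange and finiteness of Bruhat intervals\<close>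

lemma word_eval_simps [simp]:
  "word_eval W [] = \<one>\<^bsub>W\<^esub>"
  "word_eval W (s # ws) = s \<otimes>\<^bsub>W\<^esub> word_eval W ws"
  by (simp_all add: word_eval_def)

section \<open>Words over the generators and the reflections they cross\<close>

context coxeter_system
begin

lemma inv_cancel [simp]:
  assumes "g \<in> carrier W" "x \<in> carrier W"
  shows "inv g \<otimes> (g \<otimes> x) = x" "g \<otimes> (inv g \<otimes> x) = x"
  using assms by (simp_all flip: m_assoc)

lemma S_closed [simp]: "s \<in> S \<Longrightarrow> s \<in> carrier W"
  using generators_subset by auto

lemma gen_square [simp]: "s \<in> S \<Longrightarrow> s \<otimes> s = \<one>"
proof -
  assume s: "s \<in> S"
  have "s [^] group.ord W s = \<one>" using s by (intro pow_ord_eq_1) auto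
  then show ?thesis using generators_order[OF s] s by (simp add: numeral_2_eq_2)
qed

lemma gen_inv [simp]: "s \<in> S \<Longrightarrow> inv s = s"
  by (rule inv_equality) auto

lemma word_eval_closed [simp]: "set ws \<subseteq> S \<Longrightarrow> word_eval W ws \<in> carrier W"
  by (induction ws) auto

lemma word_eval_append [simp]:
  "\<lbrakk>set xs \<subseteq> S; set ys \<subseteq> S\<rbrakk> \<Longrightarrow>
    word_eval W (xs @ ys) = word_eval W xs \<otimes> word_eval W ys"
  by (induction xs) (auto simp: m_assoc)

lemma word_eval_rev: "set ws \<subseteq> S \<Longrightarrow> word_eval W (rev ws) = inv (word_eval W ws)"
proof (induction ws)
  case (Cons s ws)
  then show ?case by (simp add: inv_mult_group)
qed simp

lemma word_exists: "w \<in> carrier W \<Longrightarrow> \<exists>ws. set ws \<subseteq> S \<and> word_eval W ws = w"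
proof -
  assume "w \<in> carrier W"
  then have "w \<in> generate W S" using generators_generate by simp
  then show ?thesis
  proof (induction w)
    case one
    show ?case by (intro exI[of _ "[]"]) auto
  next
    case (incl s)
    then show ?case by (intro exI[of _ "[s]"]) auto
  next
    case (inv s)
    then show ?case by (intro exI[of _ "[s]"]) auto
  next
    case (eng g h)
    then obtain xs ys where "set xs \<subseteq> S" "word_eval W xs = g" "set ys \<subseteq> S" "word_eval W ys = h"
      by blast
    then show ?case by (intro exI[of _ "xs @ ys"]) auto
  qed
qed

lemma reduced_word_exists:
  assumes "w \<in> carrier W"
  obtains ws where "set ws \<subseteq> S" "word_eval W ws = w" "length ws = cox_length W S w"
proof -
  have "\<exists>n. \<exists>ws\<in>lists S. length ws = n \<and> word_eval W ws = w"
    using word_exists[OF assms] by (auto simp: lists_eq_set)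
  from LeastI_ex[OF this] show ?thesis
    using that unfolding cox_length_def by (auto simp: lists_eq_set)
qed

lemma cox_length_le: "set ws \<subseteq> S \<Longrightarrow> cox_length W S (word_eval W ws) \<le> length ws"
  unfolding cox_length_def lists_eq_set by (intro Least_le) auto

lemma reflection_closed [simp]: "t \<in> reflections W S \<Longrightarrow> t \<in> carrier W"
  by (auto simp: reflections_def)

lemma reflection_square [simp]: "t \<in> reflections W S \<Longrightarrow> t \<otimes> t = \<one>"
proof -
  assume "t \<in> reflections W S"
  then obtain w s where ws: "w \<in> carrier W" "s \<in> S" "t = w \<otimes> s \<otimes> inv w"
    unfolding reflections_def by blast
  have "s \<otimes> (s \<otimes> inv w) = inv w" using ws(1,2) by (simp flip: m_assoc)
  then show "t \<otimes> t = \<one>" using ws(1,2) unfolding ws(3) by (simp add: m_assoc)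
qed

lemma reflection_inv [simp]: "t \<in> reflections W S \<Longrightarrow> inv t = t"
  by (rule inv_equality) auto

lemma reflection_conj:
  assumes "t \<in> reflections W S" "g \<in> carrier W"
  shows "g \<otimes> t \<otimes> inv g \<in> reflections W S"
proof -
  obtain w s where ws: "w \<in> carrier W" "s \<in> S" "t = w \<otimes> s \<otimes> inv w"
    using assms unfolding reflections_def by blast
  then have "g \<otimes> t \<otimes> inv g = (g \<otimes> w) \<otimes> s \<otimes> inv (g \<otimes> w)"
    using assms by (simp add: m_assoc inv_mult_group)
  then show ?thesis
    unfolding reflections_def using ws assms by blast
qed

text \<open>For a word \<open>s1 ... sk\<close> the i-th entry is \<open>s_i\<close> conjugated by
  \<open>s1 ... s_(i-1)\<close>. Multiplying the value of the word by this entry on the left deletes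
  the i-th letter.\<close>

fun word_reflections :: "'a list \<Rightarrow> 'a list" where
  "word_reflections [] = []"
| "word_reflections (s # ws) = s # map (\<lambda>r. s \<otimes> r \<otimes> inv s) (word_reflections ws)"

lemma word_reflections_closed: "set ws \<subseteq> S \<Longrightarrow> set (word_reflections ws) \<subseteq> carrier W"
  by (induction ws) auto

lemma word_reflections_append:
  "\<lbrakk>set xs \<subseteq> S; set ys \<subseteq> S\<rbrakk> \<Longrightarrow> word_reflections (xs @ ys) =
    word_reflections xs @
      map (\<lambda>r. word_eval W xs \<otimes> r \<otimes> inv (word_eval W xs)) (word_reflections ys)"
proof (induction xs)
  case Nil
  show ?case
    using word_reflections_closed[OF Nil(2)] by (auto intro!: map_idI[symmetric])
next
  case (Cons s xs)
  then show ?case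
    using word_reflections_closed[OF Cons.prems(2)]
    by (auto simp: m_assoc inv_mult_group)
qed

text \<open>Dyer's reflection cocycle, as a function of words: modulo two, the count of
  \<open>t\<close> turns out to depend only on the value of the word.\<close>

definition reflection_parity :: "'a list \<Rightarrow> 'a \<Rightarrow> bool" where
  "reflection_parity ws t \<longleftrightarrow> odd (count_list (word_reflections ws) t)"

lemma count_list_conj:
  assumes "g \<in> carrier W" "t \<in> carrier W"
  shows "set l \<subseteq> carrier W \<Longrightarrow>
    count_list (map (\<lambda>r. g \<otimes> r \<otimes> inv g) l) t = count_list l (inv g \<otimes> t \<otimes> g)"
proof (induction l)
  case (Cons r l)
  have "g \<otimes> r \<otimes> inv g = t \<longleftrightarrow> r = inv g \<otimes> t \<otimes> g"
    using Cons.prems assms by (auto simp: m_assoc)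
  then show ?case using Cons by auto
qed simp

lemma reflection_parity_append:
  assumes "set xs \<subseteq> S" "set ys \<subseteq> S" "t \<in> carrier W"
  shows "reflection_parity (xs @ ys) t \<longleftrightarrow>
    reflection_parity xs t \<noteq>
      reflection_parity ys (inv (word_eval W xs) \<otimes> t \<otimes> word_eval W xs)"
  using assms word_reflections_closed[of ys]
  by (simp add: reflection_parity_def word_reflections_append count_list_conj)

text \<open>Conjugation by \<open>s t\<close> raises the exponent in \<open>(s t)^i s\<close> by
  two, so a new pair \<open>s, t\<close> in front supplies the exponents 0 and 1 and shifts all
  others.\<close>

lemma word_reflections_alternating:
  assumes "s \<in> S" "t \<in> S"
  shows "word_reflections (concat (replicate k [s, t])) =
    map (\<lambda>i. (s \<otimes> t) [^] i \<otimes> s) [0..<2 * k]"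
proof (induction k)
  case (Suc k)
  let ?w = "concat (replicate k [s, t])"
  have lists: "set (?w) \<subseteq> S" using assms by (induction k) auto
  have conj: "s \<otimes> t \<otimes> ((s \<otimes> t) [^] i \<otimes> s) \<otimes> inv (s \<otimes> t) = (s \<otimes> t) [^] (i + 2) \<otimes> s"
    for i :: nat
  proof -
    have "s \<otimes> t \<otimes> ((s \<otimes> t) [^] i \<otimes> s) \<otimes> inv (s \<otimes> t)
        = (s \<otimes> t \<otimes> (s \<otimes> t) [^] i) \<otimes> (s \<otimes> t) \<otimes> s"
      using assms by (simp add: m_assoc inv_mult_group)
    also have "s \<otimes> t \<otimes> (s \<otimes> t) [^] i = (s \<otimes> t) [^] Suc i"
      using assms nat_pow_Suc2[of "s \<otimes> t" i] by simp
    finally show ?thesis by simp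
  qed
  have "word_reflections (concat (replicate (Suc k) [s, t])) =
      [s, s \<otimes> t \<otimes> inv s] @ map (\<lambda>i. (s \<otimes> t) [^] (i + 2) \<otimes> s) [0..<2 * k]"
    using word_reflections_append[of "[s, t]" ?w] assms lists
    by (simp add: Suc conj del: Suc_eq_plus1)
  also have "\<dots> = map (\<lambda>i. (s \<otimes> t) [^] i \<otimes> s) [0..<2 * Suc k]"
  proof -
    have "map f [0..<2 * Suc k] = [f 0, f 1] @ map (\<lambda>i. f (i + 2)) [0..<2 * k]"
      for f :: "nat \<Rightarrow> 'a"
    proof -
      have "[0..<2 * Suc k] = [0, 1] @ map (\<lambda>i. i + 2) [0..<2 * k]"
        unfolding map_add_upt by (simp add: upt_conv_Cons numeral_2_eq_2 del: upt_Suc)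
      then show ?thesis by (simp only: map_append map_map comp_def list.map)
    qed
    from this[of "\<lambda>i. (s \<otimes> t) [^] i \<otimes> s"] show ?thesis using assms by simp
  qed
  finally show ?case .
qed simp

text \<open>The reflections of a relator have the exponents 0 to 2m - 1. As \<open>(a b)^m\<close>
  is the identity, the second half repeats the first and every count is even. The relator also has
  value one, so the letters after it keep their reflections when it is removed.\<close>

lemma relator_deletion:
  assumes "coxeter_relator_deletion W S xs ys"
  shows "set xs \<subseteq> S" "set ys \<subseteq> S"
    "t \<in> carrier W \<Longrightarrow> reflection_parity xs t = reflection_parity ys t"
proof -
  obtain ps qs a b where *: "set ps \<subseteq> S" "set qs \<subseteq> S" "a \<in> S" "b \<in> S"
      "xs = ps @ concat (replicate (group.ord W (a \<otimes> b)) [a, b]) @ qs" "ys = ps @ qs"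
    using assms by (cases rule: coxeter_relator_deletion.cases) (auto simp: lists_eq_set)
  define m where "m = group.ord W (a \<otimes> b)"
  define c where "c = concat (replicate m [a, b])"
  have c: "set (concat (replicate k [a, b])) \<subseteq> S" for k using * by (induction k) auto
  have ev: "word_eval W (concat (replicate k [a, b])) = (a \<otimes> b) [^] k" for k
  proof (induction k)
    case (Suc k)
    then show ?case using * c[of k] nat_pow_Suc2[of "a \<otimes> b" k] by (simp add: m_assoc)
  qed simp
  have pm: "(a \<otimes> b) [^] m = \<one>" unfolding m_def using * by (intro pow_ord_eq_1) auto
  then have ev1: "word_eval W c = \<one>" by (simp add: ev c_def)
  have rf: "(a \<otimes> b) [^] (i + m) \<otimes> a = (a \<otimes> b) [^] i \<otimes> a" for i
    using * pm by (simp flip: nat_pow_mult)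
  have "word_reflections c = map (\<lambda>i. (a \<otimes> b) [^] i \<otimes> a) ([0..<m] @ [m..<m + m])"
    unfolding c_def using * upt_add_eq_append[of 0 m m]
    by (simp add: word_reflections_alternating mult_2)
  also have "[m..<m + m] = map (\<lambda>i. i + m) [0..<m]" by (simp add: map_add_upt)
  also have "map (\<lambda>i. (a \<otimes> b) [^] i \<otimes> a) ([0..<m] @ map (\<lambda>i. i + m) [0..<m]) =
      map (\<lambda>i. (a \<otimes> b) [^] i \<otimes> a) [0..<m] @ map (\<lambda>i. (a \<otimes> b) [^] i \<otimes> a) [0..<m]"
    by (simp add: rf comp_def)
  finally have even: "\<not> reflection_parity c r" for r
    by (simp add: reflection_parity_def)
  show "set xs \<subseteq> S" "set ys \<subseteq> S" using * c by auto
  assume t: "t \<in> carrier W"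
  have "xs = ps @ c @ qs" using * by (simp add: c_def m_def)
  moreover have "set c \<subseteq> S" using c by (simp add: c_def)
  ultimately show "reflection_parity xs t = reflection_parity ys t"
    using * t even[of "inv word_eval W ps \<otimes> t \<otimes> word_eval W ps"]
    by (simp add: reflection_parity_append ev1)
qed

text \<open>Here the presentation of the group enters: words with equal value are joined by
  insertions and deletions of relators.\<close>

lemma reflection_parity_cong:
  assumes "set xs \<subseteq> S" "set ys \<subseteq> S" "word_eval W xs = word_eval W ys" "t \<in> carrier W"
  shows "reflection_parity xs t = reflection_parity ys t"
proof -
  have "equivclp (coxeter_relator_deletion W S) xs ys"
    using presentation[of xs ys] assms(1-3) by (auto simp: lists_eq_set)
  then show ?thesis
  proof (induction rule: equivclp_induct)
    case base
    show ?case ..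
  next
    case (step y z)
    then show ?case using relator_deletion(3)[OF _ assms(4)] by metis
  qed
qed

text \<open>Since \<open>p @ rev p\<close> has value one, its two halves contribute equal parities
  at \<open>t\<close>. Inserting the middle letter \<open>s\<close> adds exactly one
  occurrence.\<close>

lemma reflection_parity_self:
  assumes "set p \<subseteq> S" "s \<in> S" "t = word_eval W p \<otimes> s \<otimes> inv (word_eval W p)"
  shows "reflection_parity (p @ s # rev p) t"
proof -
  define g where "g = word_eval W p"
  have g [simp]: "g \<in> carrier W" using assms by (simp add: g_def)
  have t: "t = g \<otimes> s \<otimes> inv g" "t \<in> carrier W" using assms by (auto simp: g_def)
  have c1: "inv g \<otimes> t \<otimes> g = s"
    using assms(2) by (simp add: t(1) m_assoc)
  have rp: "set (rev p) \<subseteq> S" using assms by auto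
  have "\<not> reflection_parity (p @ rev p) t"
    using reflection_parity_cong[of "p @ rev p" "[]" t] assms rp t
    by (simp add: word_eval_rev reflection_parity_def)
  then have "reflection_parity p t = reflection_parity (rev p) s"
    using reflection_parity_append[of p "rev p" t] assms rp t c1 by (simp flip: g_def)
  moreover have "reflection_parity (s # rev p) s \<longleftrightarrow> \<not> reflection_parity (rev p) s"
    using reflection_parity_append[of "[s]" "rev p" s] assms rp
    by (simp add: reflection_parity_def)
  ultimately show ?thesis
    using reflection_parity_append[of p "s # rev p" t] assms rp t c1 by (simp flip: g_def)
qed

lemma word_reflections_deletion:
  assumes "set us \<subseteq> S" "t \<in> set (word_reflections us)"
  shows "\<exists>vs. set vs \<subseteq> S \<and> length vs < length us \<and> word_eval W vs = t \<otimes> word_eval W us"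
  using assms
proof (induction us arbitrary: t)
  case (Cons s us)
  show ?case
  proof (cases "t = s")
    case True
    then show ?thesis
      using Cons.prems by (intro exI[of _ us]) (simp_all flip: m_assoc)
  next
    case False
    then obtain r where r: "r \<in> set (word_reflections us)" "t = s \<otimes> r \<otimes> inv s"
      using Cons.prems by auto
    then obtain vs where vs: "set vs \<subseteq> S" "length vs < length us"
        "word_eval W vs = r \<otimes> word_eval W us"
      using Cons.IH[OF _ r(1)] Cons.prems by auto
    have "r \<in> carrier W" using r Cons.prems word_reflections_closed[of us] by auto
    then have "t \<otimes> word_eval W (s # us) = s \<otimes> r \<otimes> (s \<otimes> s) \<otimes> word_eval W us"
      using r Cons.prems by (simp add: m_assoc del: gen_square)
    with vs show ?thesis
      using Cons.prems \<open>r \<in> carrier W\<close> by (intro exI[of _ "s # vs"]) (auto simp: m_assoc)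
  qed
qed simp

text \<open>Strong exchange. A reduced word of \<open>t w\<close> has even parity at
  \<open>t\<close>, for otherwise a deletion would give a word of \<open>w\<close> shorter than the
  length of \<open>t w\<close>. A palindromic word of \<open>t\<close> has odd parity at
  \<open>t\<close>, and conjugation by \<open>t\<close> fixes \<open>t\<close>, so the concatenation
  has odd parity. It has value \<open>w\<close>, hence so does every other word of
  \<open>w\<close>.\<close>

lemma left_inversion_in_word_reflections:
  assumes "set ws \<subseteq> S" "t \<in> left_inversions W S (word_eval W ws)"
  shows "t \<in> set (word_reflections ws)"
proof -
  define w where "w = word_eval W ws"
  have w: "w \<in> carrier W" using assms by (simp add: w_def)
  have t: "t \<in> reflections W S" and less: "cox_length W S (t \<otimes> w) < cox_length W S w"
    using assms by (auto simp: left_inversions_def w_def)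
  obtain g s where gs: "g \<in> carrier W" "s \<in> S" "t = g \<otimes> s \<otimes> inv g"
    using t unfolding reflections_def by blast
  obtain p where p: "set p \<subseteq> S" "word_eval W p = g" using word_exists gs by blast
  obtain us where us: "set us \<subseteq> S" "word_eval W us = t \<otimes> w"
      "length us = cox_length W S (t \<otimes> w)"
    using reduced_word_exists[of "t \<otimes> w"] t w by auto
  have tt: "t \<otimes> (t \<otimes> w) = w" using t w by (simp flip: m_assoc)
  have tp: "set (p @ s # rev p) \<subseteq> S" "word_eval W (p @ s # rev p) = t"
    using p gs by (auto simp: word_eval_rev m_assoc)
  have "\<not> reflection_parity us t"
  proof
    assume "reflection_parity us t"
    then have "t \<in> set (word_reflections us)"
      by (auto simp: reflection_parity_def intro: ccontr)
    then obtain vs where "set vs \<subseteq> S" "length vs < length us" "word_eval W vs = w"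
      using word_reflections_deletion[OF us(1)] us tt by metis
    then show False using cox_length_le[of vs] us less by simp
  qed
  moreover have "reflection_parity (p @ s # rev p) t"
    using p gs by (intro reflection_parity_self) auto
  ultimately have "reflection_parity ((p @ s # rev p) @ us) t"
    using reflection_parity_append[OF tp(1) us(1), of t] t unfolding tp(2) by simp
  moreover have "word_eval W ((p @ s # rev p) @ us) = w"
    using word_eval_append[OF tp(1) us(1)] unfolding tp(2) us(2) tt .
  ultimately have "reflection_parity ws t"
    using reflection_parity_cong[of "(p @ s # rev p) @ us" ws t] tp us assms t
    by (simp add: w_def)
  then show ?thesis by (auto simp: reflection_parity_def intro: ccontr)
qed

section \<open>Finiteness of lower Bruhat sets\<close>

lemma bruhat_edgesD:
  assumes "(u, v) \<in> bruhat_edges W S"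
  shows "u \<in> carrier W" "v \<in> carrier W" "cox_length W S u < cox_length W S v"
    "inv u \<otimes> v \<in> reflections W S"
  using assms by (auto simp: bruhat_edges_def)

text \<open>The label of an edge is an involution multiplied on the right. Conjugated by
  \<open>u\<close> it becomes \<open>u v^-1\<close>, a left inversion of \<open>v\<close>, and by
  strong exchange a single word of \<open>v\<close> lists all of these.\<close>

lemma finite_bruhat_predecessors: "finite {u. (u, v) \<in> bruhat_edges W S}"
proof (cases "v \<in> carrier W")
  case True
  then obtain ws where ws: "set ws \<subseteq> S" "word_eval W ws = v" using word_exists by blast
  have "{u. (u, v) \<in> bruhat_edges W S} \<subseteq> (\<lambda>r. r \<otimes> v) ` set (word_reflections ws)"
  proof safe
    fix u assume e: "(u, v) \<in> bruhat_edges W S"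
    note d = bruhat_edgesD[OF e]
    have "inv (inv u \<otimes> v) = inv u \<otimes> v" using d by simp
    then have "inv v \<otimes> u = inv u \<otimes> v" using d(1,2) by (simp add: inv_mult_group del: reflection_inv)
    then have "u \<otimes> (inv u \<otimes> v) \<otimes> inv u = u \<otimes> (inv v \<otimes> u) \<otimes> inv u" by simp
    also have "\<dots> = u \<otimes> inv v" using d by (simp add: m_assoc)
    finally have "u \<otimes> inv v \<in> reflections W S"
      using reflection_conj[OF d(4,1)] by simp
    moreover have uv: "u \<otimes> inv v \<otimes> v = u" using d by (simp add: m_assoc)
    ultimately have "u \<otimes> inv v \<in> left_inversions W S v"
      using d by (simp add: left_inversions_def)
    then have "u \<otimes> inv v \<in> set (word_reflections ws)"
      using left_inversion_in_word_reflections[of ws] ws by simp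
    then show "u \<in> (\<lambda>r. r \<otimes> v) ` set (word_reflections ws)"
      using uv by (intro image_eqI[of _ _ "u \<otimes> inv v"]) auto
  qed
  then show ?thesis by (rule finite_subset) simp
qed (auto simp: bruhat_edges_def)

lemma finite_bruhat_lower: "finite {u. bruhat_less W S u v}"
proof (induction "cox_length W S v" arbitrary: v rule: less_induct)
  case less
  let ?P = "{u. (u, v) \<in> bruhat_edges W S}"
  have "{u. bruhat_less W S u v} \<subseteq> ?P \<union> (\<Union>y \<in> ?P. {u. bruhat_less W S u y})"
    by (auto simp: bruhat_less_def elim: tranclE)
  moreover have "finite (?P \<union> (\<Union>y \<in> ?P. {u. bruhat_less W S u y}))"
    using less finite_bruhat_predecessors by (auto dest: bruhat_edgesD(3))
  ultimately show ?case by (rule finite_subset)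
qed

end

subsection \<open>Polynomials in c and d\<close>

lemma ad_swap_swap [simp]: "ad_swap (ad_swap a) = a"
  by (cases a) auto

lemma map_ad_swap_swap [simp]: "map ad_swap (map ad_swap w) = w"
  by (induction w) auto

lemma nc_subst_superset:
  assumes "finite K" "Poly_Mapping.keys p \<subseteq> K"
  shows "nc_subst f p =
    (\<Sum>M \<in> K. of_int (Poly_Mapping.lookup p M) * prod_list (map f (letters M)))"
  unfolding nc_subst_def using assms
  by (intro sum.mono_neutral_left) (auto simp: in_keys_iff)

lemma nc_subst_add: "nc_subst f (p + q) = nc_subst f p + nc_subst f q"
proof -
  let ?K = "Poly_Mapping.keys p \<union> Poly_Mapping.keys q"
  have "Poly_Mapping.keys (p + q) \<subseteq> ?K" by (rule keys_add)
  then show ?thesis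
    by (simp add: nc_subst_superset[of ?K] lookup_add sum.distrib distrib_right)
qed

lemma nc_subst_single [simp]:
  "nc_subst f (Poly_Mapping.single M k) = of_int k * prod_list (map f (letters M))"
  by (cases "k = 0") (simp_all add: nc_subst_def)

lemma nc_subst_zero [simp]: "nc_subst f 0 = 0"
  by (simp add: nc_subst_def)

lemma nc_subst_diff: "nc_subst f (p - q) = nc_subst f p - nc_subst f q"
  using nc_subst_add[of f "p - q" q] by (simp add: eq_diff_eq)

text \<open>Both sides are additive in \<open>p\<close>, so the induction principle of free abelian
  groups reduces the claim to single monomials.\<close>

lemma nc_subst_var_mult: "nc_subst f (nc_var a * p) = f a * nc_subst f p"
using subset_UNIV[of "Poly_Mapping.keys p"]
proof (induction p rule: frag_induction)
  case (one M)
  show ?case by (simp add: nc_var_def mult_single plus_monom_def)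
next
  case (diff p q)
  then show ?case by (simp add: right_diff_distrib nc_subst_diff)
qed simp_all

section \<open>Coefficients of words, and a functional dual to the cd-monomials\<close>

definition word_coeff :: "'x ncpoly \<Rightarrow> 'x list \<Rightarrow> int" where
  "word_coeff p w = Poly_Mapping.lookup p (Monom w)"

lemma word_coeff_simps [simp]:
  "word_coeff (p + q) w = word_coeff p w + word_coeff q w"
  "word_coeff (p - q) w = word_coeff p w - word_coeff q w"
  "word_coeff 0 w = 0"
  "word_coeff (Poly_Mapping.single (Monom v) k) w = (k when v = w)"
  "word_coeff (sum h I) w = (\<Sum>i \<in> I. word_coeff (h i) w)"
  by (simp_all add: word_coeff_def lookup_add lookup_minus lookup_single lookup_sum)

lemma ncpoly_eqI: "(\<And>w. word_coeff p w = word_coeff q w) \<Longrightarrow> p = q"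
  unfolding word_coeff_def by (metis monom.exhaust poly_mapping_eqI)

lemma word_coeff_var_mult [simp]:
  "word_coeff (nc_var a * p) [] = 0"
  "word_coeff (nc_var a * p) (b # w) = (if b = a then word_coeff p w else 0)"
proof -
  have "word_coeff (nc_var a * p) w =
      (case w of [] \<Rightarrow> 0 | b # w' \<Rightarrow> if b = a then word_coeff p w' else 0)" for w
  using subset_UNIV[of "Poly_Mapping.keys p"]
proof (induction p rule: frag_induction)
    case (one M)
    then show ?case
      by (cases M; cases w) (auto simp: nc_var_def mult_single plus_monom_def when_def)
  next
    case (diff p q)
    then show ?case by (auto simp: right_diff_distrib split: list.split)
  qed (auto split: list.split)
  then show "word_coeff (nc_var a * p) [] = 0"
    "word_coeff (nc_var a * p) (b # w) = (if b = a then word_coeff p w else 0)" by simp_all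
qed

lemma word_coeff_of_int: "word_coeff (of_int k) w = (k when w = [])"
  by (simp add: word_coeff_def lookup_of_int zero_monom_def)

lemma word_coeff_one [simp]: "word_coeff 1 w = (1 when w = [])"
  using word_coeff_of_int[of 1 w] by simp

lemma word_coeff_of_int_mult [simp]: "word_coeff (of_int k * p) w = k * word_coeff p w"
proof -
  have nat: "word_coeff (of_nat n * p) w = int n * word_coeff p w" for n
    by (induction n) (simp_all add: distrib_right)
  obtain m n where k: "k = int m - int n" by (rule int_diff_cases)
  show ?thesis by (simp add: k left_diff_distrib nat)
qed

text \<open>Let \<open>f\<close> be the coefficients of \<open>c g + d h\<close> with
  \<open>g\<close> invariant under the swap. In the clause for \<open>Letd\<close> the contributions
  of \<open>g\<close> to the two terms cancel and \<open>h\<close> remains. The clause for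
  \<open>Letc\<close> yields \<open>g\<close> plus an error \<open>D h\<close>, which the rest of
  the functional annihilates if \<open>h\<close> is swap-invariant.\<close>

fun cd_functional :: "cd_letter list \<Rightarrow> (ad_letter list \<Rightarrow> int) \<Rightarrow> int" where
  "cd_functional [] f = f []"
| "cd_functional (Letc # N) f = cd_functional N (\<lambda>w. f (LetA # w))"
| "cd_functional (Letd # N) f = cd_functional N
     (\<lambda>w. f (LetD # LetA # w) - f (LetD # LetD # map ad_swap w))"

lemma cd_functional_diff:
  "cd_functional N (\<lambda>w. f w - g w) = cd_functional N f - cd_functional N g"
proof (induction N f arbitrary: g rule: cd_functional.induct)
  case (3 N f)
  have "cd_functional (Letd # N) (\<lambda>w. f w - g w) = cd_functional N (\<lambda>w.
      (f (LetD # LetA # w) - f (LetD # LetD # map ad_swap w)) -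
      (g (LetD # LetA # w) - g (LetD # LetD # map ad_swap w)))"
    by (simp add: algebra_simps)
  then show ?case by (simp add: 3)
qed simp_all

lemma cd_functional_zero: "cd_functional N (\<lambda>w. 0) = 0"
  using cd_functional_diff[of N "\<lambda>w. 0" "\<lambda>w. 0"] by simp

lemma cd_functional_add:
  "cd_functional N (\<lambda>w. f w + g w) = cd_functional N f + cd_functional N g"
proof -
  have "cd_functional N (\<lambda>w. (f w + g w) - g w) = cd_functional N (\<lambda>w. f w + g w) - cd_functional N g"
    by (rule cd_functional_diff)
  then show ?thesis by simp
qed

lemma cd_functional_sum:
  "cd_functional N (\<lambda>w. \<Sum>i \<in> I. f i w) = (\<Sum>i \<in> I. cd_functional N (f i))"
  by (induction I rule: infinite_finite_induct) (auto simp: cd_functional_zero cd_functional_add)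

lemma cd_functional_scale:
  "cd_functional N (\<lambda>w. k * f w) = k * cd_functional N f"
  by (induction N f rule: cd_functional.induct) (simp_all flip: right_diff_distrib)

lemma word_coeff_cd [simp]:
  "word_coeff (cd_to_ad Letc * q) [] = 0"
  "word_coeff (cd_to_ad Letc * q) (a # w) = word_coeff q w"
  "word_coeff (cd_to_ad Letd * q) [] = 0"
  "word_coeff (cd_to_ad Letd * q) [a] = 0"
  "word_coeff (cd_to_ad Letd * q) (a # b # w) = (if a = b then 0 else word_coeff q w)"
  by (cases a; (cases b)?; simp add: distrib_right mult.assoc)+

lemma word_coeff_cd_monomial_swap:
  "word_coeff (prod_list (map cd_to_ad K)) (map ad_swap w) =
    word_coeff (prod_list (map cd_to_ad K)) w"
proof (induction K arbitrary: w)
  case Nil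
  show ?case by (simp add: when_def)
next
  case (Cons z K)
  have eq: "ad_swap a = ad_swap b \<longleftrightarrow> a = b" for a b
    by (metis ad_swap_swap)
  consider "w = []" | a where "w = [a]" | a b w' where "w = a # b # w'"
    by (metis list.exhaust)
  then show ?case
    by cases (cases z; simp add: Cons[of "_ # _", simplified] Cons eq del: cd_to_ad.simps)+
qed

text \<open>The error term \<open>D q\<close>: a leading \<open>Letc\<close> looks only at words
  starting with \<open>A\<close>, and a leading \<open>Letd\<close> compares values of
  \<open>q\<close> at swapped words.\<close>

lemma cd_functional_var_mult:
  assumes "\<And>w. word_coeff q (map ad_swap w) = word_coeff q w"
  shows "cd_functional N (word_coeff (nc_var LetD * q)) = 0"
proof (cases N)
  case (Cons z N')
  have "word_coeff q (LetD # map ad_swap w) = word_coeff q (LetA # w)" for w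
    using assms[of "LetA # w"] by simp
  then show ?thesis using Cons by (cases z) (simp_all add: cd_functional_zero)
qed simp

text \<open>Equal leading letters are stripped by the matching clause. A leading \<open>Letd\<close>
  against \<open>c K'\<close> gives zero by swap invariance of \<open>K'\<close>; a leading
  \<open>Letc\<close> against \<open>d K'\<close> leaves \<open>D K'\<close>, which is
  annihilated.\<close>

lemma cd_functional_monomial:
  "cd_functional N (word_coeff (prod_list (map cd_to_ad K))) = (if K = N then 1 else 0)"
proof (induction N arbitrary: K)
  case Nil
  show ?case
  proof (cases K)
    case (Cons z K')
    then show ?thesis by (cases z) (simp_all del: cd_to_ad.simps)
  qed simp
next
  case (Cons y N)
  let ?q = "\<lambda>K. word_coeff (prod_list (map cd_to_ad K))"
  note swap = word_coeff_cd_monomial_swap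
  show ?case
  proof (cases K)
    case Nil
    have "?q [] (a # w) = 0" for a w
      by simp
    then show ?thesis using Nil by (cases y) (simp_all add: cd_functional_zero del: list.map)
  next
    case K: (Cons z K')
    show ?thesis
    proof (cases z; cases y)
      assume "z = Letc" "y = Letd"
      moreover have "?q K' (LetD # map ad_swap w) = ?q K' (LetA # w)" for w
        using swap[of K' "LetA # w"] by simp
      ultimately show ?thesis using K by (simp add: cd_functional_zero del: cd_to_ad.simps)
    next
      assume "z = Letd" "y = Letc"
      then have "?q K (LetA # w) = word_coeff (nc_var LetD * prod_list (map cd_to_ad K')) w" for w
        unfolding K using \<open>z = Letd\<close>
        by (cases w; cases "hd w") (auto simp del: cd_to_ad.simps)
      then show ?thesis
        using cd_functional_var_mult[of "prod_list (map cd_to_ad K')" N] swap K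
          \<open>z = Letd\<close> \<open>y = Letc\<close> by (simp del: cd_to_ad.simps)
    qed (use Cons K in \<open>simp_all add: swap cd_functional_zero del: cd_to_ad.simps\<close>)
  qed
qed

lemma cd_functional_nc_subst:
  "cd_functional N (word_coeff (nc_subst cd_to_ad p)) = word_coeff p N"
proof -
  have "word_coeff (nc_subst cd_to_ad p) = (\<lambda>w. \<Sum>M \<in> Poly_Mapping.keys p.
      Poly_Mapping.lookup p M * word_coeff (prod_list (map cd_to_ad (letters M))) w)"
    by (simp add: nc_subst_def fun_eq_iff)
  then have "cd_functional N (word_coeff (nc_subst cd_to_ad p)) =
      (\<Sum>M \<in> Poly_Mapping.keys p. Poly_Mapping.lookup p M * (if letters M = N then 1 else 0))"
    by (simp add: cd_functional_sum cd_functional_scale cd_functional_monomial)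
  also have "\<dots> = (\<Sum>M \<in> Poly_Mapping.keys p. if M = Monom N then Poly_Mapping.lookup p M else 0)"
    by (intro sum.cong) (auto simp: monom.expand)
  also have "\<dots> = word_coeff p N"
    by (simp add: word_coeff_def in_keys_iff)
  finally show ?thesis .
qed

section \<open>Closure properties of the polynomials in c and d\<close>

definition cd_polys :: "ad_letter ncpoly set" where
  "cd_polys = range (nc_subst cd_to_ad)"

lemma cd_polys_add: "p \<in> cd_polys \<Longrightarrow> q \<in> cd_polys \<Longrightarrow> p + q \<in> cd_polys"
  by (auto simp: cd_polys_def simp flip: nc_subst_add)

lemma cd_polys_diff: "p \<in> cd_polys \<Longrightarrow> q \<in> cd_polys \<Longrightarrow> p - q \<in> cd_polys"
  by (auto simp: cd_polys_def simp flip: nc_subst_diff)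

lemma cd_polys_of_int: "of_int k \<in> cd_polys"
  unfolding cd_polys_def by (rule range_eqI[of _ _ "Poly_Mapping.single (Monom []) k"]) simp

lemma cd_polys_zero: "0 \<in> cd_polys"
  using cd_polys_of_int[of 0] by simp

lemma cd_polys_sum: "(\<And>i. i \<in> I \<Longrightarrow> p i \<in> cd_polys) \<Longrightarrow> sum p I \<in> cd_polys"
  by (induction I rule: infinite_finite_induct) (auto intro: cd_polys_zero cd_polys_add)

lemma cd_polys_mult: "p \<in> cd_polys \<Longrightarrow> cd_to_ad z * p \<in> cd_polys"
  by (auto simp: cd_polys_def simp flip: nc_subst_var_mult)

lemma cd_polys_scale: "p \<in> cd_polys \<Longrightarrow> of_int k * p \<in> cd_polys"
proof -
  have nat: "of_nat n * p \<in> cd_polys" if "p \<in> cd_polys" for n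
    using that by (induction n) (auto simp: distrib_right intro: cd_polys_zero cd_polys_add)
  assume p: "p \<in> cd_polys"
  obtain m n where k: "k = int m - int n" by (rule int_diff_cases)
  show ?thesis using p by (simp add: k left_diff_distrib nat cd_polys_diff)
qed

lemma nc_subst_cd_to_ad_eqD:
  assumes "nc_subst cd_to_ad p = nc_subst cd_to_ad q"
  shows "p = q"
  by (rule ncpoly_eqI) (metis assms cd_functional_nc_subst)

text \<open>The coefficients of the preimage of \<open>p + p\<close> are values of an additive
  functional at \<open>p + p\<close>, hence even. Halving them gives a preimage of \<open>p\<close>,
  so the coefficients stay integral.\<close>

lemma cd_polys_half:
  assumes "p + p \<in> cd_polys"
  shows "p \<in> cd_polys"
proof -
  obtain q where q: "p + p = nc_subst cd_to_ad q"
    using assms by (auto simp: cd_polys_def)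
  have even: "even (Poly_Mapping.lookup q M)" for M
  proof -
    have "word_coeff q (letters M) = cd_functional (letters M) (word_coeff (p + p))"
      using cd_functional_nc_subst[of "letters M" q] by (simp only: q)
    also have "word_coeff (p + p) = (\<lambda>w. word_coeff p w + word_coeff p w)" by auto
    finally have "word_coeff q (letters M) =
        cd_functional (letters M) (word_coeff p) + cd_functional (letters M) (word_coeff p)"
      by (simp only: cd_functional_add)
    then show ?thesis by (simp add: word_coeff_def)
  qed
  define h where "h = Poly_Mapping.map (\<lambda>k. k div 2) q"
  have "q = h + h"
    by (rule poly_mapping_eqI) (use even in \<open>auto simp: h_def lookup_add Poly_Mapping.map.rep_eq when_def elim!: evenE\<close>)
  then have "p + p = nc_subst cd_to_ad h + nc_subst cd_to_ad h"
    using q by (simp add: nc_subst_add)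
  then have "p = nc_subst cd_to_ad h"
    using word_coeff_simps(1)[of p p] word_coeff_simps(1)[of "nc_subst cd_to_ad h" "nc_subst cd_to_ad h"]
    by (intro ncpoly_eqI) (metis mult_2 mult_cancel_left zero_neq_numeral)
  then show ?thesis by (simp add: cd_polys_def)
qed

text \<open>The hypothesis gives existence for the definite description; uniqueness is the
  injectivity of the substitution, since the functionals recover all coefficients.\<close>

lemma cd_functional_complete_cd_index:
  assumes "complete_ad_index W S R u v \<in> cd_polys"
  shows "Poly_Mapping.lookup (complete_cd_index W S R u v) M =
    cd_functional (letters M) (word_coeff (complete_ad_index W S R u v))"
proof -
  obtain p where p: "nc_subst cd_to_ad p = complete_ad_index W S R u v"
    using assms by (auto simp: cd_polys_def)
  then have "complete_cd_index W S R u v = p"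
    unfolding complete_cd_index_def
    by (intro the_equality) (auto intro: nc_subst_cd_to_ad_eqD)
  then show ?thesis
    using cd_functional_nc_subst[of "letters M" p] p by (simp add: word_coeff_def)
qed

text \<open>The homogeneous polynomial of degree \<open>n\<close> with coefficients
  \<open>h\<close>; the recursive form exposes the leading letter.\<close>

fun word_poly :: "nat \<Rightarrow> (ad_letter list \<Rightarrow> int) \<Rightarrow> ad_letter ncpoly" where
  "word_poly 0 h = of_int (h [])"
| "word_poly (Suc n) h = nc_var LetA * word_poly n (\<lambda>w. h (LetA # w)) +
     nc_var LetD * word_poly n (\<lambda>w. h (LetD # w))"

lemma word_coeff_word_poly:
  "word_coeff (word_poly n h) w = (h w when length w = n)"
proof (induction n arbitrary: h w)
  case 0
  show ?case by (auto simp: word_coeff_of_int when_def)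
next
  case (Suc n)
  show ?case
  proof (cases w)
    case (Cons a w')
    then show ?thesis by (cases a) (simp_all add: Suc)
  qed simp
qed

subsection \<open>Words of paths\<close>

text \<open>A letter as a function of three consecutive vertices, so that prepending a vertex to a
  path prepends a letter and leaves the rest of the word alone.\<close>

definition turn_letter :: "('a, 'b) monoid_scheme \<Rightarrow> 'a rel \<Rightarrow> 'a \<Rightarrow> 'a \<Rightarrow> 'a \<Rightarrow> ad_letter" where
  "turn_letter W R a b c =
    (if (inv\<^bsub>W\<^esub> a \<otimes>\<^bsub>W\<^esub> b, inv\<^bsub>W\<^esub> b \<otimes>\<^bsub>W\<^esub> c) \<in> R then LetA else LetD)"

lemma path_letter_one: "path_letter W R (u # y) 1 = turn_letter W R u (y ! 0) (y ! Suc 0)"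
  by (simp add: path_letter_def turn_letter_def edge_label_def)

lemma path_letter_Suc: "1 \<le> m \<Longrightarrow> path_letter W R (u # y) (Suc m) = path_letter W R y m"
  by (cases m) (simp_all add: path_letter_def edge_label_def)

lemma path_word_Cons:
  assumes "2 \<le> length y"
  shows "path_word W R (u # y) = turn_letter W R u (y ! 0) (y ! Suc 0) # path_word W R y"
proof -
  have "[1..<length y] = 1 # map Suc [1..<length y - 1]"
  proof -
    obtain k where "length y = Suc k" "1 \<le> k" using assms by (cases "length y") auto
    then show ?thesis by (simp add: map_Suc_upt upt_conv_Cons del: upt_Suc)
  qed
  moreover have "map (path_letter W R (u # y) \<circ> Suc) [1..<length y - 1] =
      map (path_letter W R y) [1..<length y - 1]"
    using path_letter_Suc[of _ W R u y] by auto
  ultimately show ?thesis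
    by (simp add: path_word_def path_letter_one[simplified])
qed

lemma length_path_word [simp]: "length (path_word W R x) = length x - 2"
  by (simp add: path_word_def)

lemma path_nth_0: "x \<in> paths_of_length W S n u v \<Longrightarrow> x ! 0 = u"
  by (cases x) (auto simp: paths_of_length_def)

lemma length_path: "x \<in> paths_of_length W S n u v \<Longrightarrow> length x = n + 2"
  by (simp add: paths_of_length_def)

lemma last_path: "x \<in> paths_of_length W S n u v \<Longrightarrow> last x = v"
  by (simp add: paths_of_length_def)

lemma paths_of_length_0:
  "paths_of_length W S 0 u v = (if (u, v) \<in> bruhat_edges W S then {[u, v]} else {})"
  by (auto simp: paths_of_length_def length_Suc_conv numeral_2_eq_2)

lemma paths_of_length_Suc:
  "paths_of_length W S (Suc n) u v =
    (\<Union>z \<in> {z. (u, z) \<in> bruhat_edges W S}. (#) u ` paths_of_length W S n z v)"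
  (is "?L = ?R")
proof (intro equalityI subsetI)
  fix x assume "x \<in> ?L"
  moreover from this obtain z y where "x = u # z # y"
    by (auto simp: paths_of_length_def length_Suc_conv)
  ultimately show "x \<in> ?R"
    by (auto simp: paths_of_length_def intro!: image_eqI[of _ _ "z # y"])
next
  fix x assume "x \<in> ?R"
  then obtain z y where "(u, z) \<in> bruhat_edges W S" "y \<in> paths_of_length W S n z v" "x = u # y"
    by auto
  then show "x \<in> ?L" by (cases y) (auto simp: paths_of_length_def)
qed

lemma bruhat_less_of_path: "x \<in> paths_of_length W S n u v \<Longrightarrow> bruhat_less W S u v"
proof (induction n arbitrary: u x)
  case 0
  then show ?case by (auto simp: paths_of_length_0 bruhat_less_def split: if_splits)
next
  case (Suc n)
  then show ?case by (auto simp: paths_of_length_Suc bruhat_less_def intro: trancl_into_trancl2)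
qed

lemma paths_eq_of_length: "x \<in> paths W S u v \<longleftrightarrow> x \<in> paths_of_length W S (length x - 2) u v"
  by (auto simp: paths_def paths_of_length_def)

text \<open>The product defining \<open>s_monom\<close>, as a recursion along the path. This is
  possible because the m-th factor depends only on the part of the path from the vertex
  \<open>m - 1\<close> on.\<close>

fun s_word :: "('a, 'b) monoid_scheme \<Rightarrow> 'a rel \<Rightarrow> ('a \<Rightarrow> 'a \<Rightarrow> 'a list \<Rightarrow> 'a list) \<Rightarrow>
    ad_letter list \<Rightarrow> 'a list \<Rightarrow> int" where
  "s_word W R F [] x = 1"
| "s_word W R F (a # w) x = s_letter W R F 1 a x * s_word W R F w (tl x)"

lemma s_letter_Suc:
  assumes "1 \<le> m" "y \<noteq> []"
  shows "s_letter W R F (Suc m) a (u # y) = s_letter W R F m a y"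
proof -
  have "flip_tail F (Suc m) (u # y) = u # flip_tail F m y"
    using assms by (simp add: flip_tail_def)
  then show ?thesis
    using assms by (cases a) (simp_all add: path_letter_Suc)
qed

lemma s_word_eq_prod:
  "length w < length x \<Longrightarrow> s_word W R F w x = (\<Prod>m = 1..length w. s_letter W R F m (w ! (m - 1)) x)"
proof (induction w arbitrary: x)
  case (Cons a w)
  then obtain u y where x: "x = u # y" "length w < length y" by (cases x) auto
  have "(\<Prod>m = 1..length (a # w). s_letter W R F m ((a # w) ! (m - 1)) x) =
      s_letter W R F 1 a x * (\<Prod>m = 1..length w. s_letter W R F (Suc m) (w ! (m - 1)) x)"
    by (simp add: prod.atLeast_Suc_atMost prod.atLeast_Suc_atMost_Suc_shift nth_Cons' 
        del: prod.cl_ivl_Suc)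
  also have "(\<Prod>m = 1..length w. s_letter W R F (Suc m) (w ! (m - 1)) x) =
      (\<Prod>m = 1..length w. s_letter W R F m (w ! (m - 1)) y)"
    using x by (intro prod.cong refl) (auto simp del: s_letter.simps intro!: s_letter_Suc)
  finally show ?case using Cons.IH[of y] x by simp
qed simp

lemma cd_word_simps [simp]:
  "cd_word (Monom []) = []"
  "cd_word (Monom (Letc # N)) = LetA # cd_word (Monom N)"
  "cd_word (Monom (Letd # N)) = LetD # LetA # cd_word (Monom N)"
  by (simp_all add: cd_word_def)

lemma cd_degree_simps [simp]:
  "cd_degree (Monom []) = 0"
  "cd_degree (Monom (Letc # N)) = Suc (cd_degree (Monom N))"
  "cd_degree (Monom (Letd # N)) = Suc (Suc (cd_degree (Monom N)))"
  by (simp_all add: cd_degree_def)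

lemma length_cd_word: "length (cd_word M) = cd_degree M"
proof (cases M)
  case (Monom N)
  have "length (cd_word (Monom N)) = cd_degree (Monom N)"
  proof (induction N)
    case (Cons z N)
    then show ?case by (cases z) auto
  qed simp
  then show ?thesis using Monom by simp
qed

lemma s_monom_eq_s_word:
  "x \<in> paths_of_length W S (cd_degree M) u v \<Longrightarrow> s_monom W R F M x = s_word W R F (cd_word M) x"
  by (simp add: s_monom_def s_word_eq_prod length_cd_word length_path)

text \<open>The set \<open>Z\<close> for the second vertex carries the condition that a letter in
  front imposes on the rest of the path.\<close>

definition path_count ::
  "('a, 'b) monoid_scheme \<Rightarrow> 'a set \<Rightarrow> 'a rel \<Rightarrow> 'a \<Rightarrow> 'a set \<Rightarrow> 'a \<Rightarrow> ad_letter list \<Rightarrow> int" where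
  "path_count W S R u Z v w =
    (\<Sum>x | x \<in> paths_of_length W S (length w) u v \<and> x ! Suc 0 \<in> Z. of_bool (path_word W R x = w))"

lemma path_count_Nil: "path_count W S R u Z v [] = of_bool ((u, v) \<in> bruhat_edges W S \<and> v \<in> Z)"
proof -
  have "{x. x \<in> paths_of_length W S 0 u v \<and> x ! Suc 0 \<in> Z} =
      (if (u, v) \<in> bruhat_edges W S \<and> v \<in> Z then {[u, v]} else {})"
    by (auto simp: paths_of_length_0)
  then show ?thesis by (simp add: path_count_def path_word_def)
qed

section \<open>Finiteness of path sets and recursion on the first edge\<close>

context coxeter_system
begin

lemma finite_paths_of_length: "finite (paths_of_length W S n u v)"
proof (induction n arbitrary: u)
  case 0
  show ?case by (simp add: paths_of_length_0)
next
  case (Suc n)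
  \<comment> \<open>There may be infinitely many edges out of \<open>u\<close>, but only finitely
    many of them end below \<open>v\<close>.\<close>
  have "paths_of_length W S (Suc n) u v \<subseteq>
      (\<Union>z \<in> {z. bruhat_less W S z v}. (#) u ` paths_of_length W S n z v)"
    by (auto simp: paths_of_length_Suc dest: bruhat_less_of_path)
  then show ?case
    by (rule finite_subset) (simp add: finite_bruhat_lower Suc)
qed

lemma path_length_bound:
  "x \<in> paths_of_length W S n u v \<Longrightarrow> n < cox_length W S v - cox_length W S u"
proof (induction n arbitrary: u x)
  case 0
  then show ?case by (auto simp: paths_of_length_0 dest: bruhat_edgesD(3) split: if_splits)
next
  case (Suc n)
  then obtain z y where "(u, z) \<in> bruhat_edges W S" "y \<in> paths_of_length W S n z v"
    by (auto simp: paths_of_length_Suc)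
  then show ?case using Suc.IH[of y z] bruhat_edgesD(3)[of u z] by linarith
qed

lemma finite_paths: "finite (paths W S u v)"
proof -
  have "paths W S u v \<subseteq> (\<Union>n < cox_length W S v. paths_of_length W S n u v)"
    by (force simp: paths_def dest: path_length_bound)
  then show ?thesis by (rule finite_subset) (simp add: finite_paths_of_length)
qed

lemma sum_paths_of_length_Suc:
  assumes "finite Y" "{z. bruhat_less W S z v} \<subseteq> Y"
  shows "(\<Sum>x | x \<in> paths_of_length W S (Suc n) u v \<and> x ! Suc 0 \<in> Z. g x) =
    (\<Sum>z \<in> {z \<in> Y. (u, z) \<in> bruhat_edges W S \<and> z \<in> Z}. \<Sum>y \<in> paths_of_length W S n z v. g (u # y))"
proof -
  let ?Y = "{z \<in> Y. (u, z) \<in> bruhat_edges W S \<and> z \<in> Z}"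
  have "{x. x \<in> paths_of_length W S (Suc n) u v \<and> x ! Suc 0 \<in> Z} =
      (\<Union>z \<in> ?Y. (#) u ` paths_of_length W S n z v)"
  proof (intro equalityI subsetI)
    fix x assume "x \<in> {x. x \<in> paths_of_length W S (Suc n) u v \<and> x ! Suc 0 \<in> Z}"
    then obtain z y where y: "(u, z) \<in> bruhat_edges W S" "y \<in> paths_of_length W S n z v"
        "x = u # y" "x ! Suc 0 \<in> Z"
      unfolding paths_of_length_Suc by blast
    have "z \<in> Y" using bruhat_less_of_path[OF y(2)] assms(2) by blast
    then show "x \<in> (\<Union>z \<in> ?Y. (#) u ` paths_of_length W S n z v)"
      using y path_nth_0[OF y(2)] by auto
  next
    fix x assume "x \<in> (\<Union>z \<in> ?Y. (#) u ` paths_of_length W S n z v)"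
    then obtain z y where y: "z \<in> ?Y" "y \<in> paths_of_length W S n z v" "x = u # y"
      by blast
    then show "x \<in> {x. x \<in> paths_of_length W S (Suc n) u v \<and> x ! Suc 0 \<in> Z}"
      using path_nth_0[OF y(2)] unfolding paths_of_length_Suc by auto
  qed
  moreover have "((#) u ` paths_of_length W S n z v) \<inter> ((#) u ` paths_of_length W S n z' v) = {}"
    if "z \<noteq> z'" for z z'
    using that by (auto dest!: path_nth_0)
  ultimately have "(\<Sum>x | x \<in> paths_of_length W S (Suc n) u v \<and> x ! Suc 0 \<in> Z. g x) =
      (\<Sum>z \<in> ?Y. sum g ((#) u ` paths_of_length W S n z v))"
    using assms(1) by (simp only:) (rule sum.UNION_disjoint, auto simp: finite_paths_of_length)
  also have "\<dots> = (\<Sum>z \<in> ?Y. \<Sum>y \<in> paths_of_length W S n z v. g (u # y))"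
    by (rule sum.cong[OF refl]) (simp add: sum.reindex)
  finally show ?thesis .
qed

lemma path_count_Cons:
  assumes "finite Y" "{z. bruhat_less W S z v} \<subseteq> Y"
  shows "path_count W S R u Z v (a # w) =
    (\<Sum>z \<in> {z \<in> Y. (u, z) \<in> bruhat_edges W S \<and> z \<in> Z}.
      path_count W S R z {c. turn_letter W R u z c = a} v w)"
proof -
  have "(\<Sum>y \<in> paths_of_length W S (length w) z v. of_bool (path_word W R (u # y) = a # w)) =
      path_count W S R z {c. turn_letter W R u z c = a} v w" for z
  proof -
    have "(\<Sum>y \<in> paths_of_length W S (length w) z v. of_bool (path_word W R (u # y) = a # w)) =
        (\<Sum>y \<in> paths_of_length W S (length w) z v.
          if y ! Suc 0 \<in> {c. turn_letter W R u z c = a} then of_bool (path_word W R y = w) else (0::int))"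
      by (intro sum.cong refl) (auto simp: path_word_Cons length_path path_nth_0)
    then show ?thesis
      by (simp add: path_count_def sum.inter_filter[symmetric] finite_paths_of_length)
  qed
  then show ?thesis
    by (subst path_count_def) (simp add: sum_paths_of_length_Suc[OF assms, simplified])
qed

end

text \<open>These assumptions are stable under reversing \<open>R\<close>, as shown in
  \<open>flip_system_converse\<close>; every result below thus holds for both orders.\<close>

locale flip_system = coxeter_system W S for W :: "('a, 'b) monoid_scheme" (structure) and S +
  fixes R :: "'a rel" and F :: "'a \<Rightarrow> 'a \<Rightarrow> 'a list \<Rightarrow> 'a list"
  assumes linear: "strict_linear_order_on (reflections W S) R"
    and flip: "is_flip W S R F"
    and compatible: "compatible_flip W S R F"
begin

text \<open>Equal consecutive labels would multiply to one and force \<open>a = c\<close>, against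
  the increase of length. So the two labels are strictly comparable in exactly one
  direction.\<close>

lemma turn_letter_converse:
  assumes "(a, b) \<in> bruhat_edges W S" "(b, c) \<in> bruhat_edges W S"
  shows "turn_letter W (R\<inverse>) a b c = ad_swap (turn_letter W R a b c)"
proof -
  note ab = bruhat_edgesD[OF assms(1)] and bc = bruhat_edgesD[OF assms(2)]
  have "inv a \<otimes> b \<noteq> inv b \<otimes> c"
  proof
    assume eq: "inv a \<otimes> b = inv b \<otimes> c"
    have "(inv a \<otimes> b) \<otimes> (inv b \<otimes> c) = \<one>" using reflection_square[OF ab(4)] eq by simp
    then have "inv a \<otimes> c = \<one>" using ab(1,2) bc(2) by (simp add: m_assoc)
    then have "a \<otimes> (inv a \<otimes> c) = a" using ab(1) by simp
    then show False using ab bc by simp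
  qed
  then have "(inv a \<otimes> b, inv b \<otimes> c) \<in> R \<longleftrightarrow> (inv b \<otimes> c, inv a \<otimes> b) \<notin> R"
    using linear ab(4) bc(4)
    unfolding strict_linear_order_on_def irrefl_def trans_def total_on_def by metis
  then show ?thesis by (simp add: turn_letter_def)
qed

lemma path_word_converse:
  "x \<in> paths_of_length W S n u v \<Longrightarrow> path_word W (R\<inverse>) x = map ad_swap (path_word W R x)"
proof (induction n arbitrary: u x)
  case 0
  then show ?case by (auto simp: paths_of_length_0 path_word_def split: if_splits)
next
  case (Suc n)
  then obtain z y where y: "(u, z) \<in> bruhat_edges W S" "y \<in> paths_of_length W S n z v" "x = u # y"
    by (auto simp: paths_of_length_Suc)
  have "(z, y ! Suc 0) \<in> bruhat_edges W S"
    using y(2) by (cases y; cases "tl y") (auto simp: paths_of_length_def)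
  then show ?case
    using y Suc.IH[OF y(2)] turn_letter_converse[OF y(1)]
    by (simp add: path_word_Cons length_path path_nth_0[OF y(2), simplified])
qed

text \<open>A flip preserves the length of a path because swapping letters preserves the length of
  its word.\<close>

lemma flip_path:
  assumes "x \<in> paths_of_length W S n u v"
  shows "F u v x \<in> paths_of_length W S n u v" "F u v (F u v x) = x"
    "path_word W R (F u v x) = map ad_swap (path_word W R x)"
proof -
  have "bruhat_less W S u v" "x \<in> paths W S u v"
    using assms bruhat_less_of_path by (auto simp: paths_def)
  then have Fx: "F u v x \<in> paths W S u v" "F u v (F u v x) = x"
    "path_word W R (F u v x) = map ad_swap (path_word W R x)"
    using flip by (auto simp: is_flip_def)
  have "length (F u v x) - 2 = n"
    using arg_cong[OF Fx(3), of length] length_path[OF assms] by simp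
  then show "F u v x \<in> paths_of_length W S n u v" using Fx(1) paths_eq_of_length by metis
  show "F u v (F u v x) = x" "path_word W R (F u v x) = map ad_swap (path_word W R x)"
    by (rule Fx)+
qed

end

subsection \<open>Summation over paths with a compatible flip\<close>

lemma strict_linear_order_on_converse:
  "strict_linear_order_on A r \<Longrightarrow> strict_linear_order_on A (r\<inverse>)"
  by (simp add: strict_linear_order_on_def)

context flip_system
begin

lemma flip_system_converse: "flip_system W S (R\<inverse>) F"
proof unfold_locales
  show "strict_linear_order_on (reflections W S) (R\<inverse>)"
    using linear by (rule strict_linear_order_on_converse)
  show "is_flip W S (R\<inverse>) F"
    unfolding is_flip_def
  proof (intro allI impI ballI)
    fix u v x assume uv: "bruhat_less W S u v" and "x \<in> paths W S u v"
    then obtain n where x: "x \<in> paths_of_length W S n u v" by (auto simp: paths_def)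
    then show "F u v x \<in> paths W S u v \<and> F u v (F u v x) = x \<and>
        path_word W (R\<inverse>) (F u v x) = map ad_swap (path_word W (R\<inverse>) x)"
      using flip_path[OF x] path_word_converse[OF x] path_word_converse[OF flip_path(1)[OF x]]
      by (auto simp: paths_def)
  qed
  show "compatible_flip W S (R\<inverse>) F"
    unfolding compatible_flip_def
  proof (intro allI impI ballI)
    fix u v x M
    assume uv: "bruhat_less W S u v" and x: "x \<in> paths_of_length W S (cd_degree M) u v"
    then have "s_monom W R F M (F u v x) = s_monom W (R\<inverse>) F M (F u v (F u v x))"
      using compatible flip_path(1)[OF x] by (auto simp: compatible_flip_def)
    then show "s_monom W (R\<inverse>) F M x = s_monom W ((R\<inverse>)\<inverse>) F M (F u v x)"
      using flip_path(2)[OF x] by simp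
  qed
qed

lemma s_word_flip:
  assumes "x \<in> paths_of_length W S (cd_degree M) u v"
  shows "s_word W R F (cd_word M) (F u v x) = s_word W (R\<inverse>) F (cd_word M) x"
proof -
  interpret converse: flip_system W S "R\<inverse>" F by (rule flip_system_converse)
  have "s_monom W (R\<inverse>) F M x = s_monom W ((R\<inverse>)\<inverse>) F M (F u v x)"
    using converse.compatible assms bruhat_less_of_path[OF assms]
    unfolding compatible_flip_def by blast
  then show ?thesis
    using s_monom_eq_s_word[OF assms] s_monom_eq_s_word[OF flip_path(1)[OF assms]] by simp
qed

lemma s_word_flip_converse:
  assumes "x \<in> paths_of_length W S (cd_degree M) u v"
  shows "s_word W (R\<inverse>) F (cd_word M) (F u v x) = s_word W R F (cd_word M) x"
  using s_word_flip[OF flip_path(1)[OF assms]] flip_path(2)[OF assms] by simp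

lemma s_letter_LetA_path:
  assumes "y \<in> paths_of_length W S n z v"
  shows "s_letter W R F 1 LetA (u # y) = of_bool (turn_letter W R u z (y ! Suc 0) = LetA)"
  using path_nth_0[OF assms] path_letter_one[of W R u y] by simp

text \<open>The values 1, -1 and 0 form a difference of two indicators, one for the path and one for
  its flipped tail, which can be summed separately.\<close>

lemma s_letter_LetD_path:
  assumes "y \<in> paths_of_length W S n z v"
  shows "s_letter W R F 1 LetD (u # y) = of_bool (turn_letter W R u z (y ! Suc 0) = LetD) -
    of_bool (turn_letter W R u z (F z v y ! Suc 0) = LetD)"
proof -
  have "y \<noteq> []" using length_path[OF assms] by auto
  then have "flip_tail F 1 (u # y) = u # F z v y"
    using path_nth_0[OF assms] last_path[OF assms] by (simp add: flip_tail_def)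
  then have "path_letter W R (flip_tail F 1 (u # y)) 1 = turn_letter W R u z (F z v y ! Suc 0)"
    using path_letter_one[of W R u "F z v y"] path_nth_0[OF flip_path(1)[OF assms]] by simp
  moreover have "path_letter W R (u # y) 1 = turn_letter W R u z (y ! Suc 0)"
    using path_letter_one[of W R u y] path_nth_0[OF assms] by simp
  ultimately show ?thesis
    by (cases "turn_letter W R u z (y ! Suc 0)"; cases "turn_letter W R u z (F z v y ! Suc 0)")
      (simp_all only: s_letter.simps Let_def, simp_all)
qed

lemma path_count_converse: "path_count W S (R\<inverse>) u Z v w = path_count W S R u Z v (map ad_swap w)"
proof -
  have "path_word W (R\<inverse>) x = w \<longleftrightarrow> path_word W R x = map ad_swap w"
    if "x \<in> paths_of_length W S (length w) u v" for x
    using path_word_converse[OF that] map_ad_swap_swap by metis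
  then show ?thesis
    unfolding path_count_def length_map by (intro sum.cong[OF refl]) simp
qed

text \<open>Reindexing by the flip. The second vertex is unrestricted here, since the flip may move
  it.\<close>

lemma path_count_swap: "path_count W S R u UNIV v (map ad_swap w) = path_count W S R u UNIV v w"
proof -
  have "path_word W R (F u v x) = w \<longleftrightarrow> path_word W R x = map ad_swap w"
    if "x \<in> paths_of_length W S (length w) u v" for x
    using flip_path(3)[OF that] map_ad_swap_swap by metis
  then show ?thesis unfolding path_count_def length_map
    by (intro sum.reindex_bij_witness[where i = "F u v" and j = "F u v"])
      (simp_all add: flip_path(1,2))
qed

end

text \<open>The second vertex is restricted as in \<open>path_count\<close>, so that both obey
  parallel recursions.\<close>

definition s_sum ::
  "('a, 'b) monoid_scheme \<Rightarrow> 'a set \<Rightarrow> 'a rel \<Rightarrow> ('a \<Rightarrow> 'a \<Rightarrow> 'a list \<Rightarrow> 'a list) \<Rightarrow>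
    'a \<Rightarrow> 'a set \<Rightarrow> 'a \<Rightarrow> cd_letter list \<Rightarrow> int" where
  "s_sum W S R F u Z v N = (\<Sum>x | x \<in> paths_of_length W S (cd_degree (Monom N)) u v \<and> x ! Suc 0 \<in> Z.
    s_word W R F (cd_word (Monom N)) x)"

lemma sum_of_bool_mult:
  "finite A \<Longrightarrow> (\<Sum>y \<in> A. of_bool (P y) * (f y :: int)) = (\<Sum>y | y \<in> A \<and> P y. f y)"
proof -
  assume "finite A"
  then have "(\<Sum>y | y \<in> A \<and> P y. f y) = (\<Sum>y \<in> A. if P y then f y else 0)"
    by (rule sum.inter_filter)
  also have "\<dots> = (\<Sum>y \<in> A. of_bool (P y) * f y)"
    by (rule sum.cong) auto
  finally show ?thesis by (rule sym)
qed

text \<open>The factor at a letter c is the indicator of an ascent at the first turn, which becomes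
  the restriction on the second vertex of the tail.\<close>

lemma (in flip_system) s_sum_Letc:
  assumes IH: "\<And>u Z v. s_sum W S R F u Z v N = cd_functional N (path_count W S R u Z v)"
  shows "s_sum W S R F u Z v (Letc # N) = cd_functional (Letc # N) (path_count W S R u Z v)"
proof -
  define Y where "Y = {z. bruhat_less W S z v}"
  have Y: "finite Y" "{z. bruhat_less W S z v} \<subseteq> Y"
    by (auto simp: Y_def finite_bruhat_lower)
  let ?Y = "{z \<in> Y. (u, z) \<in> bruhat_edges W S \<and> z \<in> Z}"
  let ?Z = "\<lambda>z. {c. turn_letter W R u z c = LetA}"
  have "s_sum W S R F u Z v (Letc # N) = (\<Sum>z \<in> ?Y. \<Sum>y \<in> paths_of_length W S (cd_degree (Monom N)) z v.
      s_letter W R F 1 LetA (u # y) * s_word W R F (cd_word (Monom N)) y)"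
    by (simp add: s_sum_def sum_paths_of_length_Suc[OF Y] del: s_letter.simps)
  also have "\<dots> = (\<Sum>z \<in> ?Y. s_sum W S R F z (?Z z) v N)"
  proof (rule sum.cong[OF refl])
    fix z
    have "(\<Sum>y \<in> paths_of_length W S (cd_degree (Monom N)) z v.
        s_letter W R F 1 LetA (u # y) * s_word W R F (cd_word (Monom N)) y) =
      (\<Sum>y \<in> paths_of_length W S (cd_degree (Monom N)) z v.
        of_bool (y ! Suc 0 \<in> ?Z z) * s_word W R F (cd_word (Monom N)) y)"
      by (rule sum.cong[OF refl]) (simp only: s_letter_LetA_path mem_Collect_eq)
    then show "(\<Sum>y \<in> paths_of_length W S (cd_degree (Monom N)) z v.
        s_letter W R F 1 LetA (u # y) * s_word W R F (cd_word (Monom N)) y) =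
        s_sum W S R F z (?Z z) v N"
      by (simp only: s_sum_def sum_of_bool_mult[OF finite_paths_of_length])
  qed
  also have "\<dots> = cd_functional N (\<lambda>w. \<Sum>z \<in> ?Y. path_count W S R z (?Z z) v w)"
    by (simp add: IH cd_functional_sum)
  also have "\<dots> = cd_functional (Letc # N) (path_count W S R u Z v)"
    by (simp add: path_count_Cons[OF Y])
  finally show ?thesis .
qed

text \<open>
  The factor of \<open>s\<close> at the \<open>D\<close> of a letter \<open>d\<close> is \<open>[y descends] - [F y descends]\<close>, where \<open>y\<close> is the
  tail. Reindexing the second term by \<open>F\<close> leaves \<open>s y - s (F y)\<close> summed over the descending tails,
  and \<open>s (F y)\<close> is the value of \<open>s\<close> at \<open>y\<close> for the reverse order.
\<close>
lemma (in flip_system) s_sum_Letd: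
  assumes c: "\<And>u Z v. s_sum W S R F u Z v (Letc # N) =
      cd_functional (Letc # N) (path_count W S R u Z v)"
    and c': "\<And>u Z v. s_sum W S (R\<inverse>) F u Z v (Letc # N) =
      cd_functional (Letc # N) (path_count W S (R\<inverse>) u Z v)"
  shows "s_sum W S R F u Z v (Letd # N) = cd_functional (Letd # N) (path_count W S R u Z v)"
proof -
  define Y where "Y = {z. bruhat_less W S z v}"
  have Y: "finite Y" "{z. bruhat_less W S z v} \<subseteq> Y"
    by (auto simp: Y_def finite_bruhat_lower)
  let ?Y = "{z \<in> Y. (u, z) \<in> bruhat_edges W S \<and> z \<in> Z}"
  let ?Z = "\<lambda>z. {c. turn_letter W R u z c = LetD}"
  \<comment> \<open>The word of \<open>d N\<close> is \<open>D\<close> followed by the word of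
    \<open>c N\<close>, so compatibility for the monomial \<open>c N\<close> applies to the
    tails.\<close>
  let ?M = "Monom (Letc # N)"
  let ?s = "s_word W R F (cd_word ?M)" and ?s' = "s_word W (R\<inverse>) F (cd_word ?M)"
  let ?B = "\<lambda>z. paths_of_length W S (cd_degree ?M) z v"
  have word: "cd_word (Monom (Letd # N)) = LetD # cd_word ?M"
    "cd_degree (Monom (Letd # N)) = Suc (cd_degree ?M)" by simp_all
  have "s_sum W S R F u Z v (Letd # N) = (\<Sum>z \<in> ?Y. \<Sum>y \<in> ?B z. s_letter W R F 1 LetD (u # y) * ?s y)"
    unfolding s_sum_def word sum_paths_of_length_Suc[OF Y] s_word.simps list.sel ..
  also have "\<dots> = (\<Sum>z \<in> ?Y. s_sum W S R F z (?Z z) v (Letc # N) - s_sum W S (R\<inverse>) F z (?Z z) v (Letc # N))"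
  proof (rule sum.cong[OF refl])
    fix z
    have "(\<Sum>y \<in> ?B z. s_letter W R F 1 LetD (u # y) * ?s y) =
        (\<Sum>y \<in> ?B z. of_bool (y ! Suc 0 \<in> ?Z z) * ?s y) - (\<Sum>y \<in> ?B z. of_bool (F z v y ! Suc 0 \<in> ?Z z) * ?s y)"
      unfolding sum_subtractf[symmetric]
      by (rule sum.cong[OF refl]) (simp only: s_letter_LetD_path mem_Collect_eq left_diff_distrib)
    also have "(\<Sum>y \<in> ?B z. of_bool (F z v y ! Suc 0 \<in> ?Z z) * ?s y) =
        (\<Sum>y \<in> ?B z. of_bool (y ! Suc 0 \<in> ?Z z) * ?s' y)"
      by (rule sum.reindex_bij_witness[where i = "F z v" and j = "F z v"])
        (simp_all only: flip_path s_word_flip_converse)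
    finally show "(\<Sum>y \<in> ?B z. s_letter W R F 1 LetD (u # y) * ?s y) =
        s_sum W S R F z (?Z z) v (Letc # N) - s_sum W S (R\<inverse>) F z (?Z z) v (Letc # N)"
      by (simp only: s_sum_def sum_of_bool_mult[OF finite_paths_of_length])
  qed
  \<comment> \<open>Reading \<open>A w\<close> in the reverse order means reading \<open>D\<close>
    followed by the swapped \<open>w\<close> in \<open>R\<close>; this is the swap in the definition
    of \<open>cd_functional\<close>.\<close>
  also have "\<dots> = (\<Sum>z \<in> ?Y. cd_functional N (\<lambda>w. path_count W S R z (?Z z) v (LetA # w) -
      path_count W S R z (?Z z) v (LetD # map ad_swap w)))"
    by (simp add: c c' cd_functional_diff path_count_converse)
  also have "\<dots> = cd_functional (Letd # N) (path_count W S R u Z v)"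
    by (simp add: path_count_Cons[OF Y] sum_subtractf flip: cd_functional_sum)
  finally show ?thesis .
qed

text \<open>The order is generalised in the induction because a letter d calls for the claim for
  both \<open>R\<close> and its reverse.\<close>

lemma s_sum_eq_cd_functional:
  "flip_system W S R F \<Longrightarrow> s_sum W S R F u Z v N = cd_functional N (path_count W S R u Z v)"
proof (induction N arbitrary: R u Z v)
  case Nil
  have "{x. x \<in> paths_of_length W S 0 u v \<and> x ! Suc 0 \<in> Z} =
      (if (u, v) \<in> bruhat_edges W S \<and> v \<in> Z then {[u, v]} else {})"
    by (auto simp: paths_of_length_0)
  then show ?case by (simp add: s_sum_def path_count_Nil)
next
  case (Cons z N)
  interpret flip_system W S R F by fact
  interpret converse: flip_system W S "R\<inverse>" F by (rule flip_system_converse)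
  note c = s_sum_Letc[OF Cons.IH[OF flip_system_axioms]]
  note c' = converse.s_sum_Letc[OF Cons.IH[OF flip_system_converse]]
  show ?case
  proof (cases z)
    case Letd
    then show ?thesis using s_sum_Letd[OF c c'] by simp
  qed (use c in simp)
qed

text \<open>Summing over one letter lifts the condition on the turn at a vertex \<open>x\<close>.
  Cutting there gives independent paths from \<open>u\<close> to \<open>x\<close> with word
  \<open>w1\<close> and from \<open>x\<close> to \<open>v\<close> with word
  \<open>w2\<close>.\<close>

lemma (in coxeter_system) path_count_convolution:
  assumes "finite Y" "{z. bruhat_less W S z v} \<subseteq> Y"
  shows "path_count W S R u Z v (w1 @ LetA # w2) + path_count W S R u Z v (w1 @ LetD # w2) =
    (\<Sum>x \<in> Y. path_count W S R u Z x w1 * path_count W S R x UNIV v w2)"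
proof (induction w1 arbitrary: u Z)
  case Nil
  have split: "path_count W S R z {c. turn_letter W R u z c = LetA} v w2 +
      path_count W S R z {c. turn_letter W R u z c = LetD} v w2 = path_count W S R z UNIV v w2" for z
  proof -
    let ?f = "\<lambda>x. of_bool (path_word W R x = w2) :: int" and ?B = "paths_of_length W S (length w2) z v"
    let ?t = "\<lambda>x. turn_letter W R u z (x ! Suc 0)"
    have "(\<Sum>x | x \<in> ?B \<and> ?t x = LetA. ?f x) + (\<Sum>x | x \<in> ?B \<and> ?t x = LetD. ?f x) =
        (\<Sum>x \<in> ?B. of_bool (?t x = LetA) * ?f x + of_bool (?t x = LetD) * ?f x)"
      unfolding sum.distrib sum_of_bool_mult[OF finite_paths_of_length] ..
    also have "\<dots> = sum ?f ?B"
    proof (rule sum.cong[OF refl])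
      fix x show "of_bool (?t x = LetA) * ?f x + of_bool (?t x = LetD) * ?f x = ?f x"
        by (cases "?t x") simp_all
    qed
    finally show ?thesis by (simp add: path_count_def)
  qed
  have "path_count W S R u Z v (LetA # w2) + path_count W S R u Z v (LetD # w2) =
      (\<Sum>z \<in> {z \<in> Y. (u, z) \<in> bruhat_edges W S \<and> z \<in> Z}. path_count W S R z UNIV v w2)"
    by (simp add: path_count_Cons[OF assms] split flip: sum.distrib)
  also have "\<dots> = (\<Sum>x \<in> Y. of_bool ((u, x) \<in> bruhat_edges W S \<and> x \<in> Z) * path_count W S R x UNIV v w2)"
    by (simp add: sum_of_bool_mult[OF assms(1)])
  finally show ?case by (simp add: path_count_Nil)
next
  case (Cons a w1)
  let ?Y = "{z \<in> Y. (u, z) \<in> bruhat_edges W S \<and> z \<in> Z}"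
  let ?Z = "\<lambda>z. {c. turn_letter W R u z c = a}"
  have "path_count W S R u Z v ((a # w1) @ LetA # w2) + path_count W S R u Z v ((a # w1) @ LetD # w2) =
      (\<Sum>z \<in> ?Y. \<Sum>x \<in> Y. path_count W S R z (?Z z) x w1 * path_count W S R x UNIV v w2)"
    by (simp add: path_count_Cons[OF assms] Cons flip: sum.distrib)
  also have "\<dots> = (\<Sum>x \<in> Y. (\<Sum>z \<in> ?Y. path_count W S R z (?Z z) x w1) * path_count W S R x UNIV v w2)"
    by (subst sum.swap) (simp add: sum_distrib_right)
  also have "\<dots> = (\<Sum>x \<in> Y. path_count W S R u Z x (a # w1) * path_count W S R x UNIV v w2)"
  proof (rule sum.cong[OF refl])
    fix x assume "x \<in> Y"
    show "(\<Sum>z \<in> ?Y. path_count W S R z (?Z z) x w1) * path_count W S R x UNIV v w2 =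
        path_count W S R u Z x (a # w1) * path_count W S R x UNIV v w2"
    \<comment> \<open>If \<open>x\<close> is below \<open>v\<close>, then by transitivity
      \<open>Y\<close> contains everything below \<open>x\<close> and the recursion applies;
      otherwise the second factor is zero.\<close>
    proof (cases "bruhat_less W S x v")
      case True
      then have "{z. bruhat_less W S z x} \<subseteq> Y"
        using assms(2) unfolding bruhat_less_def by (auto intro: trancl_trans)
      then show ?thesis by (simp add: path_count_Cons[OF assms(1)])
    next
      case False
      then have "paths_of_length W S (length w2) x v = {}" using bruhat_less_of_path by fast
      then show ?thesis by (simp add: path_count_def)
    qed
  qed
  finally show ?case .
qed

subsection \<open>Existence of the complete cd-index\<close>

text \<open>
  Writing \<open>P\<^sub>A\<close>, \<open>P\<^sub>D\<close> for the coefficients of the leading letter, symmetry and convolution give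
  \<open>P\<^sub>A - P\<^sub>D = (D - A) P'\<close> for a family \<open>P'\<close> of the same kind. The polynomial is then
  \<open>c g + d P'\<close> with \<open>g = P\<^sub>A - D P'\<close>, and \<open>2 g = (P\<^sub>A + P\<^sub>D) - c P'\<close>.
\<close>
lemma (in flip_system) word_poly_in_cd_polys:
  assumes "\<And>v w. H v (map ad_swap w) = H v w"
    and "\<And>v w1 w2. H v (w1 @ LetA # w2) + H v (w1 @ LetD # w2) =
      (\<Sum>x | bruhat_less W S x v. H x w1 * path_count W S R x UNIV v w2)"
  shows "word_poly n (H v) \<in> cd_polys"
  using assms
\<comment> \<open>The induction hypothesis is used for \<open>H'\<close> in degree
  \<open>n - 2\<close> and for the path counts out of each \<open>x\<close> in degree
  \<open>n - 1\<close>.\<close>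
proof (induction n arbitrary: H v rule: less_induct)
  case (less n)
  note sym = less.prems(1) and conv = less.prems(2)
  have one: "H v [LetD] = H v [LetA]" for v
    using sym[of v "[LetA]"] by simp
  consider "n = 0" | "n = 1" | m where "n = Suc (Suc m)"
    by (metis One_nat_def old.nat.exhaust)
  then show ?case
  proof cases
    case 1
    then show ?thesis by (simp add: cd_polys_of_int)
  next
    case 2
    have "word_poly n (H v) = cd_to_ad Letc * of_int (H v [LetA])"
      using one[of v] by (simp add: 2 distrib_right)
    then show ?thesis by (simp only: cd_polys_mult cd_polys_of_int)
  next
    case (3 m)
    define PA where "PA = word_poly (Suc m) (\<lambda>w. H v (LetA # w))"
    define PD where "PD = word_poly (Suc m) (\<lambda>w. H v (LetD # w))"
    define H' where "H' = (\<lambda>v w. H v (LetA # LetD # w) - H v (LetD # LetD # w))"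
    define P' where "P' = word_poly m (H' v)"
    \<comment> \<open>By convolution, the sum over the second letter depends on the first letter
      only through \<open>H x [LetA]\<close> or \<open>H x [LetD]\<close>, and these agree.\<close>
    have H': "H v (LetA # LetA # w) - H v (LetD # LetA # w) = - H' v w" for v w
      using conv[of v "[LetA]" w] conv[of v "[LetD]" w] by (simp add: H'_def one)
    have "H' v (map ad_swap w) = H' v w" for v w
      using sym[of v "LetD # LetA # w"] sym[of v "LetA # LetA # w"] H'[of v w]
      by (simp add: H'_def)
    moreover have "H' v (w1 @ LetA # w2) + H' v (w1 @ LetD # w2) =
        (\<Sum>x | bruhat_less W S x v. H' x w1 * path_count W S R x UNIV v w2)" for v w1 w2
      using conv[of v "LetA # LetD # w1" w2] conv[of v "LetD # LetD # w1" w2]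
      by (simp add: H'_def left_diff_distrib sum_subtractf)
    ultimately have P': "P' \<in> cd_polys"
      unfolding P'_def using 3 by (intro less.IH) auto
    have "PA + PD = (\<Sum>x | bruhat_less W S x v. of_int (H x []) *
        word_poly (Suc m) (path_count W S R x UNIV v))"
      \<comment> \<open>Convolution at the leading letter turns \<open>PA + PD\<close> into an
        integer combination of path counts one degree lower.\<close>
      using conv[of v "[]"] by (intro ncpoly_eqI)
        (auto simp: PA_def PD_def word_coeff_word_poly when_def simp del: word_poly.simps)
    moreover have "word_poly (Suc m) (path_count W S R x UNIV v) \<in> cd_polys" for x
      by (rule less.IH[where H = "path_count W S R x UNIV"])
        (simp add: 3, rule path_count_swap, rule path_count_convolution[OF finite_bruhat_lower order_refl])
    ultimately have sum: "PA + PD \<in> cd_polys"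
      by (simp only: cd_polys_sum cd_polys_scale)
    have diff: "PD = PA - nc_var LetD * P' + nc_var LetA * P'"
    proof (rule ncpoly_eqI)
      fix w
      show "word_coeff PD w = word_coeff (PA - nc_var LetD * P' + nc_var LetA * P') w"
      proof (cases w)
        case (Cons a w')
        then show ?thesis
          using H'[of v w']
          by (cases a) (auto simp: PA_def PD_def P'_def word_coeff_word_poly when_def H'_def
            simp del: word_poly.simps)
      qed (simp add: PA_def PD_def word_coeff_word_poly del: word_poly.simps)
    qed
    \<comment> \<open>Also \<open>PD = g + A P'\<close>, so \<open>A PA + D PD\<close> is
      \<open>(A + D) g + (A D + D A) P'\<close>.\<close>
    define g where "g = PA - nc_var LetD * P'"
    have gg: "g + g = (PA + PD) - cd_to_ad Letc * P'"
      by (simp add: g_def diff algebra_simps)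
    have "g \<in> cd_polys"
    proof (rule cd_polys_half)
      show "g + g \<in> cd_polys"
        unfolding gg using sum P' by (simp only: cd_polys_diff cd_polys_mult)
    qed
    moreover have "word_poly n (H v) = cd_to_ad Letc * g + cd_to_ad Letd * P'"
    proof -
      have "word_poly n (H v) = nc_var LetA * PA + nc_var LetD * PD"
        unfolding 3 PA_def PD_def by (rule word_poly.simps(2))
      then show ?thesis by (simp add: g_def diff algebra_simps)
    qed
    ultimately show ?thesis
      using P' by (simp only: cd_polys_add cd_polys_mult)
  qed
qed

section \<open>The path polynomial of an interval and its cd-coefficients\<close>

lemma (in coxeter_system) word_coeff_complete_ad_index:
  "word_coeff (complete_ad_index W S R u v) w = path_count W S R u UNIV v w"
proof -
  have "word_coeff (complete_ad_index W S R u v) w =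
      (\<Sum>x \<in> paths W S u v. of_bool (path_word W R x = w))"
    by (simp add: complete_ad_index_def when_def of_bool_def)
  also have "\<dots> = (\<Sum>x \<in> paths_of_length W S (length w) u v. of_bool (path_word W R x = w))"
  proof (rule sum.mono_neutral_right[OF finite_paths])
    show "paths_of_length W S (length w) u v \<subseteq> paths W S u v" by (auto simp: paths_def)
    show "\<forall>x \<in> paths W S u v - paths_of_length W S (length w) u v. of_bool (path_word W R x = w) = (0::int)"
      using paths_eq_of_length by fastforce
  qed
  finally show ?thesis by (simp add: path_count_def)
qed

text \<open>Path lengths are bounded by the length of \<open>v\<close>, so the polynomial is a
  finite sum of homogeneous parts, each covered by swap symmetry and convolution.\<close>

lemma (in flip_system) complete_ad_index_in_cd_polys:
  "complete_ad_index W S R u v \<in> cd_polys"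
proof -
  let ?I = "{..<cox_length W S v}"
  have "path_count W S R u UNIV v w = 0" if "\<not> length w < cox_length W S v" for w
  proof -
    have "paths_of_length W S (length w) u v = {}"
      using that path_length_bound by fastforce
    then show ?thesis by (simp add: path_count_def)
  qed
  then have "complete_ad_index W S R u v =
      (\<Sum>n \<in> ?I. word_poly n (path_count W S R u UNIV v))"
    by (intro ncpoly_eqI)
      (auto simp: word_coeff_complete_ad_index word_coeff_word_poly when_def)
  moreover have "word_poly n (path_count W S R u UNIV v) \<in> cd_polys" for n
    by (rule word_poly_in_cd_polys[where H = "path_count W S R u UNIV"])
      (rule path_count_swap, rule path_count_convolution[OF finite_bruhat_lower order_refl])
  ultimately show ?thesis by (simp only: cd_polys_sum)
qed

theorem theorem3p1:
  fixes W :: "('a, 'b) monoid_scheme" and S :: "'a set" and R :: "'a rel"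
    and F :: "'a \<Rightarrow> 'a \<Rightarrow> 'a list \<Rightarrow> 'a list"
    and u v :: 'a and M :: "cd_letter monom" and n :: nat
  assumes "coxeter_system W S"
    and "reflection_order W S R"
    and "is_flip W S R F"
    and "compatible_flip W S R F"
    and "bruhat_less W S u v"
    and "cd_degree M = n"
  shows "Poly_Mapping.lookup (complete_cd_index W S R u v) M =
    (\<Sum>x \<in> paths_of_length W S n u v. s_monom W R F M x)"
proof -
  interpret coxeter_system W S by fact
  interpret flip_system W S R F
    using assms by unfold_locales (simp_all add: reflection_order_def)
  have word: "word_coeff (complete_ad_index W S R u v) = path_count W S R u UNIV v"
    by (rule ext) (rule word_coeff_complete_ad_index)
  have "Poly_Mapping.lookup (complete_cd_index W S R u v) M =
      cd_functional (letters M) (path_count W S R u UNIV v)"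
    using cd_functional_complete_cd_index[OF complete_ad_index_in_cd_polys] word by simp
  also have "\<dots> = s_sum W S R F u UNIV v (letters M)"
    by (rule s_sum_eq_cd_functional[symmetric]) (rule flip_system_axioms)
  also have "\<dots> = (\<Sum>x \<in> paths_of_length W S n u v. s_monom W R F M x)"
    using assms(6) by (auto simp: s_sum_def s_monom_eq_s_word intro!: sum.cong)
  finally show ?thesis .
qed

end
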